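(* Let $n \ge 1$ and let $A = \begin{bmatrix} E & F \\ F^T & G \end{bmatrix}$ be a $2n \times 2n$ real (symmetric) positive definite matrix, where $E, F, G$ are $n \times n$ real blocks. For any pinching $\mathscr{C}$ (relative to any $(m_1,\ldots,m_k)$ of positive integers with $m_1+\cdots+m_k = n$), we have $$\lambda\left( \left( \mathscr{C}(G)^{1/2}\, \mathscr{C}(E)\, \mathscr{C}(G)^{1/2} \right)^{1/2} \right) \prec^w \lambda\left( \left( G^{1/2} E G^{1/2} \right)^{1/2} \right).$$ In particular, $$\lambda\left( \mathscr{C}(E)^{1/2} \right) \prec^w \lambda\left( E^{1/2} \right).$$
   Context: For positive integers $m_1,\ldots,m_k$ with $n = m_1+\cdots+m_k$ and a real $n\times n$ matrix $H = [H_{ij}]$ partitioned into blocks $H_{ij}$ of size $m_i \times m_j$ ($1 \le i,j\le k$), the pinching of $H$ relative to $(m_1,\ldots,m_k)$ is the block-diagonal matrix $\mathscr{C}(H) = H_{11} \oplus \cdots \oplus H_{kk}$. The same $(m_1,\ldots,m_k)$ is used for $\mathscr{C}(E)$ and $\mathscr{C}(G)$. For a positive definite matrix $P$, $P^{1/2}$ is its unique positive definite square root. For a real $n \times n$ matrix $B$ all of whose eigenvalues are real, $\lambda(B) = [\lambda_1(B),\ldots,\lambda_n(B)]^T$ is the $n$-vector of its eigenvalues (with multiplicity) arranged in non-decreasing order. For $x \in \mathbb{R}^n$ let $x_1^\uparrow \le \cdots \le x_n^\uparrow$ denote its entries arranged in non-decreasing order. For $x,y\in\mathbb{R}^n$,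 $x$ is weakly supermajorized by $y$, written $x \prec^w y$, if $\sum_{j=1}^l x_j^\uparrow \ge \sum_{j=1}^l y_j^\uparrow$ for all $1 \le l \le n$. *)

theory Defs
  imports "Jordan_Normal_Form.Char_Poly"
begin

definition positive_definite :: "real mat \<Rightarrow> bool" where
  "positive_definite P \<longleftrightarrow>
     transpose_mat P = P \<and>
     (\<forall>v \<in> carrier_vec (dim_row P). v \<noteq> 0\<^sub>v (dim_row P) \<longrightarrow> v \<bullet> (P *\<^sub>v v) > 0)"

(* Meaningful for positive definite P, which have exactly one positive definite square root. *)
definition mat_sqrt :: "real mat \<Rightarrow> real mat" where
  "mat_sqrt P = (THE B. positive_definite B \<and> B * B = P)"

(* The real roots of the characteristic polynomial, with algebraic multiplicity, in
   non-decreasing order.  The vector has dimension n for an n x n matrix all of whose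
   eigenvalues are real. *)
definition eigenvalue_vec :: "real mat \<Rightarrow> real vec" where
  "eigenvalue_vec B = vec_of_list (sorted_list_of_multiset (proots (char_poly B)))"

definition mat_block :: "nat list \<Rightarrow> 'a mat \<Rightarrow> nat \<Rightarrow> nat \<Rightarrow> 'a mat" where
  "mat_block ms H i j =
     mat (ms ! i) (ms ! j)
       (\<lambda>(a, b). H $$ (sum_list (take i ms) + a, sum_list (take j ms) + b))"

definition pinching :: "nat list \<Rightarrow> 'a :: zero mat \<Rightarrow> 'a mat" where
  "pinching ms H = diag_block_mat (map (\<lambda>i. mat_block ms H i i) [0..<length ms])"

definition vec_sort :: "real vec \<Rightarrow> real vec" where
  "vec_sort x = vec_of_list (sort (list_of_vec x))"

(* Indices are 0-based, so the sum of the l smallest entries ranges over j < l. *)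
definition weakly_supermajorized :: "real vec \<Rightarrow> real vec \<Rightarrow> bool" (infix "\<prec>\<^sup>w" 50) where
  "x \<prec>\<^sup>w y \<longleftrightarrow>
     dim_vec x = dim_vec y \<and>
     (\<forall>l \<in> {1..dim_vec x}. (\<Sum>j<l. vec_sort x $ j) \<ge> (\<Sum>j<l. vec_sort y $ j))"

end

theory Submission
  imports Defs
begin

text \<open>
  For positive definite \<open>E\<close> and \<open>G\<close> let \<open>d\<^sub>1 \<le> \<dots> \<le> d\<^sub>n\<close> be the eigenvalues of
  \<open>(G\<^bsup>1/2\<^esup> E G\<^bsup>1/2\<^esup>)\<^bsup>1/2\<^esup>\<close>.  They satisfy the extremal principle
  \<open>2 (d\<^sub>1 + \<dots> + d\<^sub>l) = min (tr X\<^sup>T E X + tr Y\<^sup>T G Y)\<close> over all \<open>n \<times> l\<close> matrices \<open>X, Y\<close> with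
  \<open>X\<^sup>T Y = I\<close>: there are \<open>T, S\<close> with \<open>T\<^sup>T S = I\<close> and \<open>T\<^sup>T E T = S\<^sup>T G S = diag d\<close>, which reduces the
  lower bound to the case \<open>E = G = diag d\<close>.  That case is an induction on \<open>l\<close>: a reflection applied
  to the columns of \<open>X\<close> and \<open>Y\<close> makes all but one entry of the first row of \<open>Y\<close> vanish, so the first
  row and one column can be split off.

  Given minimizers \<open>X, Y\<close> for the pinched pair, flipping the signs of whole blocks of rows
  preserves \<open>X\<^sup>T Y = I\<close>, and a greedy choice of signs makes the contribution of the off-diagonal
  blocks of \<open>E\<close> and \<open>G\<close> to the traces nonpositive.  Hence the minimum for \<open>(E, G)\<close> is at most the
  minimum for the pinched pair.  The second claim is the case \<open>G = I\<close>.
\<close>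

subsection \<open>Reflections and weighted sums of biorthogonal systems\<close>

lemma sum_mult_of_bool_eq:
  fixes f :: "nat \<Rightarrow> real"
  assumes "b < l"
  shows "(\<Sum>c<l. f c * of_bool (c = b)) = f b"
  using assms by (simp add: of_bool_def if_distrib cong: if_cong)

text \<open>The reflection exchanging \<open>v\<close> with \<open>r\<close> times the
  \<open>m\<close>-th unit vector, where \<open>r\<close> is the norm of \<open>v\<close>. It is
  used twice: to clear a row in the extremal principle and to split off an eigenvector in the
  spectral theorem.\<close>

lemma householder_reflection:
  fixes v :: "nat \<Rightarrow> real"
  assumes m: "m < l"
  shows "\<exists>h. (\<forall>a b. h a b = h b a) \<and>
     (\<forall>a<l. \<forall>b<l. (\<Sum>c<l. h a c * h c b) = of_bool (a = b)) \<and>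
     (\<forall>b<l. b \<noteq> m \<longrightarrow> (\<Sum>c<l. v c * h c b) = (0::real))"
proof -
  define r where "r = sqrt (\<Sum>c<l. (v c)\<^sup>2)"
  define u where "u c = v c - r * of_bool (c = m)" for c
  define q where "q = (\<Sum>c<l. (u c)\<^sup>2)"
  have r2: "r\<^sup>2 = (\<Sum>c<l. (v c)\<^sup>2)"
    unfolding r_def by (simp add: sum_nonneg)
  show ?thesis
  proof (cases "q = 0")
    case True
    then have u0: "u c = 0" if "c < l" for c
      using that by (auto simp: q_def sum_nonneg_eq_0_iff)
    \<comment> \<open>Here \<open>v\<close> already is \<open>r\<close> times the unit vector; the
      reflection formula would divide by zero, and the identity serves instead.\<close>
    define h :: "nat \<Rightarrow> nat \<Rightarrow> real" where "h a b = of_bool (a = b)" for a b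
    have "(\<Sum>c<l. h a c * h c b) = of_bool (a = b)" if "a < l" "b < l" for a b
      using that by (simp add: h_def sum_mult_of_bool_eq)
    moreover have "(\<Sum>c<l. v c * h c b) = 0" if "b < l" "b \<noteq> m" for b
      using that u0[of b] by (simp add: h_def u_def sum_mult_of_bool_eq)
    ultimately show ?thesis by (intro exI[of _ h]) (auto simp: h_def)
  next
    case False
    define h :: "nat \<Rightarrow> nat \<Rightarrow> real" where "h a b = of_bool (a = b) - 2 * u a * u b / q" for a b
    have hsum: "(\<Sum>c<l. f c * h c b) = f b - 2 * (\<Sum>c<l. f c * u c) * u b / q" if "b < l" for f b
    proof -
      have "(\<Sum>c<l. f c * h c b) = (\<Sum>c<l. f c * of_bool (c = b) - f c * u c * (2 * u b / q))"
        by (simp add: h_def algebra_simps)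
      also have "\<dots> = f b - (\<Sum>c<l. f c * u c) * (2 * u b / q)"
        using that by (simp only: sum_subtractf sum_distrib_right[symmetric] sum_mult_of_bool_eq)
      finally show ?thesis by simp
    qed
    have sym: "h a b = h b a" for a b by (auto simp: h_def)
    have hu: "(\<Sum>c<l. h a c * u c) = - u a" if "a < l" for a
    proof -
      have "(\<Sum>c<l. h a c * u c) = (\<Sum>c<l. u c * h c a)"
        by (simp add: sym mult.commute)
      also have "\<dots> = u a - 2 * q * u a / q"
        using hsum[OF that, of u] by (simp add: q_def power2_eq_square)
      finally show ?thesis using False by simp
    qed
    have "(\<Sum>c<l. h a c * h c b) = of_bool (a = b)" if "a < l" "b < l" for a b
      using hsum[OF that(2), of "h a"] hu[OF that(1)] by (simp add: h_def[of a b])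
    moreover have "(\<Sum>c<l. v c * h c b) = 0" if "b < l" "b \<noteq> m" for b
    proof -
      have vu: "(\<Sum>c<l. v c * u c) = r\<^sup>2 - v m * r"
      proof -
        have "(\<Sum>c<l. v c * u c) = (\<Sum>c<l. (v c)\<^sup>2 - v c * r * of_bool (c = m))"
          by (intro sum.cong) (auto simp: u_def algebra_simps power2_eq_square)
        then show ?thesis
          using sum_mult_of_bool_eq[OF m, of "\<lambda>c. v c * r"] by (simp add: sum_subtractf r2)
      qed
      \<comment> \<open>As \<open>v\<close> and \<open>r\<close> times the unit vector have equal
        norm, \<open>q\<close> is twice the inner product of \<open>v\<close> and \<open>u\<close>.
        So \<open>hsum\<close> turns row \<open>v\<close> into \<open>v - u\<close>, which vanishes
        off position \<open>m\<close>.\<close>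
      have "q = (\<Sum>c<l. v c * u c) - (\<Sum>c<l. r * of_bool (c = m) * u c)"
        unfolding q_def sum_subtractf[symmetric]
        by (intro sum.cong) (auto simp: u_def power2_eq_square algebra_simps)
      also have "(\<Sum>c<l. r * of_bool (c = m) * u c) = r * u m"
        using sum_mult_of_bool_eq[OF m, of "\<lambda>c. r * u c"]
        by (simp add: ac_simps)
      finally have "q = 2 * (\<Sum>c<l. v c * u c)"
        unfolding vu by (simp add: u_def algebra_simps power2_eq_square)
      then show ?thesis
        using hsum[OF that(1), of v] that False by (simp add: u_def)
    qed
    ultimately show ?thesis by (intro exI[of _ h]) (auto simp: sym)
  qed
qed

text \<open>The lower bound of the extremal principle for a diagonal pair. The parameter
  \<open>k\<close> counts rows already split off; keeping it arbitrary lets the induction drop row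
  \<open>k\<close> and one column together.\<close>

lemma biorthogonal_weighted_sum_ge:
  fixes x y :: "nat \<Rightarrow> nat \<Rightarrow> real" and d :: "nat \<Rightarrow> real"
  assumes "\<And>i j. i \<le> j \<Longrightarrow> j < n \<Longrightarrow> d i \<le> d j" and "\<And>i. i < n \<Longrightarrow> 0 \<le> d i"
    and "\<And>a b. a < l \<Longrightarrow> b < l \<Longrightarrow> (\<Sum>i\<in>{k..<n}. x i a * y i b) = of_bool (a = b)"
  shows "2 * (\<Sum>j<l. d (k + j)) \<le> (\<Sum>i\<in>{k..<n}. d i * (\<Sum>a<l. (x i a)\<^sup>2 + (y i a)\<^sup>2))"
  using assms(3)
proof (induction l arbitrary: k x y)
  case 0
  then show ?case by (auto intro!: sum_nonneg mult_nonneg_nonneg assms)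
next
  case (Suc l)
  \<comment> \<open>Without remaining rows, the sum that must equal 1 for column 0 would be
    empty.\<close>
  have kn: "k < n"
  proof (rule ccontr)
    assume "\<not> k < n"
    then show False using Suc.prems[of 0 0] by simp
  qed
  \<comment> \<open>The reflection is built from row \<open>k\<close> of \<open>y\<close> but acts
    on the columns of both systems; afterwards only column \<open>l\<close> can be nonzero in row
    \<open>k\<close> of \<open>y'\<close>.\<close>
  obtain h where sym: "\<And>a b. h a b = h b a"
    and orth: "\<And>a b. a < Suc l \<Longrightarrow> b < Suc l \<Longrightarrow> (\<Sum>c<Suc l. h a c * h c b) = of_bool (a = b)"
    and zero: "\<And>b. b < l \<Longrightarrow> (\<Sum>c<Suc l. y k c * h c b) = 0"
    using householder_reflection[of l "Suc l" "y k"] by force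
  have orth': "(\<Sum>b<Suc l. h c b * h e b) = of_bool (c = e)" if "c < Suc l" "e < Suc l" for c e
    using orth[OF that] by (simp only: sym[of e])
  define x' where "x' i b = (\<Sum>c<Suc l. x i c * h c b)" for i b
  define y' where "y' i b = (\<Sum>c<Suc l. y i c * h c b)" for i b
  \<comment> \<open>Orthogonality of \<open>h\<close> preserves inner products of rows; in
    particular the row norms of \<open>x'\<close> and \<open>y'\<close> are those of
    \<open>x\<close> and \<open>y\<close>, which is needed in the last step.\<close>
  have prod: "(\<Sum>b<Suc l. (\<Sum>c<Suc l. f c * h c b) * (\<Sum>c<Suc l. g c * h c b)) = (\<Sum>c<Suc l. f c * g c)"
    for f g :: "nat \<Rightarrow> real"
  proof -
    have "(\<Sum>b<Suc l. (\<Sum>c<Suc l. f c * h c b) * (\<Sum>c<Suc l. g c * h c b))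
        = (\<Sum>b<Suc l. \<Sum>c<Suc l. \<Sum>e<Suc l. f c * g e * (h c b * h e b))"
      unfolding sum_product by (intro sum.cong refl) (simp only: ac_simps)
    also have "\<dots> = (\<Sum>c<Suc l. \<Sum>e<Suc l. f c * g e * (\<Sum>b<Suc l. h c b * h e b))"
      unfolding sum_distrib_left
      by (subst sum.swap, rule sum.cong[OF refl], rule sum.swap)
    also have "\<dots> = (\<Sum>c<Suc l. \<Sum>e<Suc l. f c * g e * of_bool (c = e))"
      using orth' by (intro sum.cong refl) simp
    also have "\<dots> = (\<Sum>c<Suc l. f c * g c)"
      by (intro sum.cong refl) (simp add: of_bool_def if_distrib cong: if_cong del: sum.lessThan_Suc)
    finally show ?thesis .
  qed
  have bi: "(\<Sum>i\<in>{k..<n}. x' i a * y' i b) = of_bool (a = b)" if "a < Suc l" "b < Suc l" for a b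
  proof -
    have "(\<Sum>i\<in>{k..<n}. x' i a * y' i b)
        = (\<Sum>i\<in>{k..<n}. \<Sum>c<Suc l. \<Sum>e<Suc l. (h c a * h e b) * (x i c * y i e))"
      unfolding x'_def y'_def sum_product by (intro sum.cong refl) (simp add: ac_simps)
    also have "\<dots> = (\<Sum>c<Suc l. \<Sum>e<Suc l. (h c a * h e b) * (\<Sum>i\<in>{k..<n}. x i c * y i e))"
      unfolding sum_distrib_left
      by (subst sum.swap, rule sum.cong[OF refl], rule sum.swap)
    also have "\<dots> = (\<Sum>c<Suc l. \<Sum>e<Suc l. (h c a * h e b) * of_bool (c = e))"
      using Suc.prems by (intro sum.cong refl) auto
    also have "\<dots> = (\<Sum>c<Suc l. h a c * h c b)"
      by (intro sum.cong refl) (simp add: of_bool_def if_distrib sym[of a] cong: if_cong del: sum.lessThan_Suc)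
    finally show ?thesis using orth that by simp
  qed
  have split: "(\<Sum>i\<in>{k..<n}. f i) = f k + (\<Sum>i\<in>{Suc k..<n}. f i)" for f :: "nat \<Rightarrow> real"
    using kn by (simp add: sum.atLeast_Suc_lessThan)
  \<comment> \<open>Row \<open>k\<close> of \<open>y'\<close> vanishes in the first \<open>l\<close>
    columns, so these columns remain biorthogonal on the rows from \<open>Suc k\<close> on.\<close>
  have IH: "2 * (\<Sum>j<l. d (Suc k + j)) \<le> (\<Sum>i\<in>{Suc k..<n}. d i * (\<Sum>a<l. (x' i a)\<^sup>2 + (y' i a)\<^sup>2))"
  proof (rule Suc.IH)
    fix a b assume ab: "a < l" "b < l"
    then have "y' k b = 0" using zero by (simp add: y'_def)
    then show "(\<Sum>i\<in>{Suc k..<n}. x' i a * y' i b) = of_bool (a = b)"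
      using bi[of a b] ab by (simp add: split)
  qed
  \<comment> \<open>The split-off column \<open>l\<close> pays for \<open>d k\<close>: its products
    sum to 1, \<open>2 * p * q\<close> is at most the sum of the squares of \<open>p\<close> and
    \<open>q\<close>, and \<open>d k\<close> is the least remaining weight.\<close>
  have "2 * d k = (\<Sum>i\<in>{k..<n}. d k * (2 * (x' i l * y' i l)))"
    using bi[of l l] by (simp add: sum_distrib_left[symmetric] mult.left_commute[of _ 2])
  also have "\<dots> \<le> (\<Sum>i\<in>{k..<n}. d i * ((x' i l)\<^sup>2 + (y' i l)\<^sup>2))"
  proof (rule sum_mono)
    fix i assume i: "i \<in> {k..<n}"
    have "d k * (2 * (x' i l * y' i l)) \<le> d k * ((x' i l)\<^sup>2 + (y' i l)\<^sup>2)"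
      using sum_squares_bound[of "x' i l" "y' i l"] assms(2)[OF kn]
      by (intro mult_left_mono) auto
    also have "\<dots> \<le> d i * ((x' i l)\<^sup>2 + (y' i l)\<^sup>2)"
      using assms(1)[of k i] i by (intro mult_right_mono) auto
    finally show "d k * (2 * (x' i l * y' i l)) \<le> d i * ((x' i l)\<^sup>2 + (y' i l)\<^sup>2)" .
  qed
  finally have dk: "2 * d k \<le> (\<Sum>i\<in>{k..<n}. d i * ((x' i l)\<^sup>2 + (y' i l)\<^sup>2))" .
  have "2 * (\<Sum>j<Suc l. d (k + j)) = 2 * d k + 2 * (\<Sum>j<l. d (Suc k + j))"
    by (simp add: sum.lessThan_Suc_shift del: sum.lessThan_Suc)
  also have "\<dots> \<le> (\<Sum>i\<in>{k..<n}. d i * ((x' i l)\<^sup>2 + (y' i l)\<^sup>2))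
      + (\<Sum>i\<in>{k..<n}. d i * (\<Sum>a<l. (x' i a)\<^sup>2 + (y' i a)\<^sup>2))"
  proof -
    have "0 \<le> d k * (\<Sum>a<l. (x' k a)\<^sup>2 + (y' k a)\<^sup>2)"
      using assms(2)[OF kn] by (intro mult_nonneg_nonneg sum_nonneg) auto
    then have "(\<Sum>i\<in>{Suc k..<n}. d i * (\<Sum>a<l. (x' i a)\<^sup>2 + (y' i a)\<^sup>2))
      \<le> (\<Sum>i\<in>{k..<n}. d i * (\<Sum>a<l. (x' i a)\<^sup>2 + (y' i a)\<^sup>2))"
      by (simp add: split)
    with dk IH show ?thesis by linarith
  qed
  also have "\<dots> = (\<Sum>i\<in>{k..<n}. d i * (\<Sum>a<Suc l. (x' i a)\<^sup>2 + (y' i a)\<^sup>2))"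
    by (simp add: sum.distrib[symmetric] algebra_simps)
  also have "\<dots> = (\<Sum>i\<in>{k..<n}. d i * (\<Sum>a<Suc l. (x i a)\<^sup>2 + (y i a)\<^sup>2))"
    unfolding sum.distrib power2_eq_square x'_def y'_def prod ..
  finally show ?case .
qed

subsection \<open>Diagonalization of real symmetric matrices\<close>

lemma mult_mat_mult_cancel_left:
  assumes "P * Q = (1\<^sub>m n :: 'a :: semiring_1 mat)"
    and "P \<in> carrier_mat n m" "Q \<in> carrier_mat m n" "X \<in> carrier_mat n k"
  shows "P * (Q * X) = X"
  using assms by (metis assoc_mult_mat left_mult_one_mat)

text \<open>Over the complex numbers there is an eigenvector \<open>z\<close> with parts
  \<open>x\<close> and \<open>y\<close>, for an eigenvalue with parts \<open>p\<close> and
  \<open>q\<close>. Symmetry equates the pairing of \<open>x\<close> with \<open>A y\<close> and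
  that of \<open>y\<close> with \<open>A x\<close>, which forces \<open>q\<close> times the squared
  norm of \<open>z\<close> to vanish. So the eigenvalue is real, and whichever of \<open>x\<close>,
  \<open>y\<close> is nonzero is a real eigenvector.\<close>

lemma symmetric_mat_has_eigenvector:
  fixes A :: "real mat"
  assumes A: "A \<in> carrier_mat n n" and sym: "transpose_mat A = A" and n: "n > 0"
  shows "\<exists>v e. v \<in> carrier_vec n \<and> v \<noteq> 0\<^sub>v n \<and> A *\<^sub>v v = e \<cdot>\<^sub>v v"
proof -
  define B where "B = map_mat complex_of_real A"
  have B: "B \<in> carrier_mat n n" using A by (simp add: B_def)
  obtain as where as: "char_poly B = (\<Prod>a\<leftarrow>as. [:- a, 1:])" "length as = n"
    using char_poly_factorized[OF B] by blast
  with n obtain a as' where "as = a # as'" by (cases as) auto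
  with as have "eigenvalue B a" by (simp add: eigenvalue_root_char_poly[OF B])
  then obtain z where z: "z \<in> carrier_vec n" "z \<noteq> 0\<^sub>v n" "B *\<^sub>v z = a \<cdot>\<^sub>v z"
    using B by (auto simp: eigenvalue_def eigenvector_def)
  define x y where "x i = Re (z $ i)" and "y i = Im (z $ i)" for i
  define p q where "p = Re a" and "q = Im a"
  have row: "(\<Sum>j<n. of_real (A $$ (i,j)) * z $ j) = a * z $ i" if "i < n" for i
  proof -
    have "(B *\<^sub>v z) $ i = (\<Sum>j<n. of_real (A $$ (i,j)) * z $ j)"
      using that A z(1) by (simp add: B_def scalar_prod_def lessThan_atLeast0)
    then show ?thesis using z that by simp
  qed
  have Ax: "(\<Sum>j<n. A $$ (i,j) * x j) = p * x i - q * y i" if "i < n" for i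
    using arg_cong[OF row[OF that], of Re] by (simp add: x_def y_def p_def q_def)
  have Ay: "(\<Sum>j<n. A $$ (i,j) * y j) = p * y i + q * x i" if "i < n" for i
    using arg_cong[OF row[OF that], of Im] by (simp add: x_def y_def p_def q_def)
  have A_sym: "A $$ (i,j) = A $$ (j,i)" if "i < n" "j < n" for i j
    using that A sym by (metis carrier_matD index_transpose_mat(1))
  have "(\<Sum>i<n. x i * (\<Sum>j<n. A $$ (i,j) * y j)) = (\<Sum>i<n. \<Sum>j<n. A $$ (j,i) * x i * y j)"
    unfolding sum_distrib_left by (intro sum.cong refl) (simp add: A_sym)
  also have "\<dots> = (\<Sum>i<n. y i * (\<Sum>j<n. A $$ (i,j) * x j))"
    unfolding sum_distrib_left by (subst sum.swap) (simp add: ac_simps)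
  finally have "(\<Sum>i<n. x i * (p * y i + q * x i)) = (\<Sum>i<n. y i * (p * x i - q * y i))"
    by (simp add: Ax Ay)
  then have "(\<Sum>i<n. x i * (p * y i + q * x i) - y i * (p * x i - q * y i)) = 0"
    by (simp only: sum_subtractf)
  also have "(\<Sum>i<n. x i * (p * y i + q * x i) - y i * (p * x i - q * y i))
      = q * (\<Sum>i<n. (x i)\<^sup>2 + (y i)\<^sup>2)"
    unfolding sum_distrib_left by (intro sum.cong refl) (simp add: algebra_simps power2_eq_square)
  finally have *: "q * (\<Sum>i<n. (x i)\<^sup>2 + (y i)\<^sup>2) = 0" .
  obtain i where i: "i < n" "z $ i \<noteq> 0"
    using z(1,2) by (metis carrier_vecD eq_vecI index_zero_vec)
  have "(\<Sum>i<n. (x i)\<^sup>2 + (y i)\<^sup>2) \<noteq> 0"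
  proof
    assume "(\<Sum>i<n. (x i)\<^sup>2 + (y i)\<^sup>2) = 0"
    then have "(x i)\<^sup>2 + (y i)\<^sup>2 = 0" using i by (subst (asm) sum_nonneg_eq_0_iff) auto
    then show False using i by (auto simp: x_def y_def complex_eq_iff sum_power2_eq_zero_iff)
  qed
  with * have q0: "q = 0" by simp
  have "A *\<^sub>v vec n w = p \<cdot>\<^sub>v vec n w" if "\<And>i. i < n \<Longrightarrow> (\<Sum>j<n. A $$ (i,j) * w j) = p * w i" for w
    using that A by (intro eq_vecI) (auto simp: scalar_prod_def lessThan_atLeast0)
  then have ex: "A *\<^sub>v vec n x = p \<cdot>\<^sub>v vec n x" "A *\<^sub>v vec n y = p \<cdot>\<^sub>v vec n y"
    using Ax Ay q0 by simp_all
  have "x i \<noteq> 0 \<or> y i \<noteq> 0" using i by (auto simp: x_def y_def complex_eq_iff)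
  then show ?thesis
  proof
    assume "x i \<noteq> 0"
    then have "vec n x \<noteq> 0\<^sub>v n" using i by (metis index_vec index_zero_vec(1))
    with ex show ?thesis by (intro exI[of _ "vec n x"]) auto
  next
    assume "y i \<noteq> 0"
    then have "vec n y \<noteq> 0\<^sub>v n" using i by (metis index_vec index_zero_vec(1))
    with ex show ?thesis by (intro exI[of _ "vec n y"]) auto
  qed
qed

text \<open>Deflation: a reflection moves an eigenvector onto the first axis, the conjugated matrix
  splits into a scalar and a smaller symmetric block, and the induction hypothesis handles that
  block.\<close>

lemma symmetric_mat_diagonalizable:
  fixes A :: "real mat"
  assumes "A \<in> carrier_mat n n" and "transpose_mat A = A"
  shows "\<exists>W d. W \<in> carrier_mat n n \<and> transpose_mat W * W = 1\<^sub>m n \<and>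
    A = W * mat_diag n d * transpose_mat W"
  using assms
proof (induction n arbitrary: A)
  case 0
  then show ?case by (intro exI[of _ "1\<^sub>m 0"] exI) (auto intro!: eq_matI)
next
  case (Suc n)
  let ?N = "Suc n"
  note [simp] = mult_carrier_mat[of _ ?N ?N _ ?N] mult_mat_vec_carrier[of _ ?N ?N]
  note assoc = assoc_mult_mat[of _ ?N ?N _ ?N _ ?N]
  note A[simp] = Suc.prems(1)
  obtain v e where v: "v \<in> carrier_vec ?N" "v \<noteq> 0\<^sub>v ?N" "A *\<^sub>v v = e \<cdot>\<^sub>v v"
    using symmetric_mat_has_eigenvector[OF Suc.prems] by auto
  obtain h where sym: "\<And>a b. h a b = h b a"
    and orth: "\<And>a b. a < ?N \<Longrightarrow> b < ?N \<Longrightarrow> (\<Sum>c<?N. h a c * h c b) = of_bool (a = b)"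
    and zero: "\<And>b. b < ?N \<Longrightarrow> b \<noteq> 0 \<Longrightarrow> (\<Sum>c<?N. v $ c * h c b) = 0"
    using householder_reflection[of 0 ?N "\<lambda>c. v $ c"] by force
  define H where "H = mat ?N ?N (\<lambda>(i,j). h i j)"
  have H[simp]: "H \<in> carrier_mat ?N ?N" by (simp add: H_def)
  have HT: "transpose_mat H = H" by (intro eq_matI) (auto simp: H_def sym)
  have HH: "H * H = 1\<^sub>m ?N"
  proof (intro eq_matI)
    fix i j assume "i < dim_row (1\<^sub>m ?N :: real mat)" "j < dim_col (1\<^sub>m ?N :: real mat)"
    then have ij: "i < ?N" "j < ?N" by auto
    then have "(H * H) $$ (i,j) = (\<Sum>c<?N. h i c * h c j)"
      by (simp add: H_def scalar_prod_def lessThan_atLeast0)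
    with orth[OF ij] ij show "(H * H) $$ (i,j) = (1\<^sub>m ?N :: real mat) $$ (i,j)" by simp
  qed (auto simp: H_def)
  \<comment> \<open>By the choice of \<open>H\<close>, the vector \<open>w\<close> is
    \<open>c\<close> times the first unit vector.\<close>
  define w where "w = H *\<^sub>v v"
  define c where "c = w $ 0"
  have w[simp]: "w \<in> carrier_vec ?N" using v by (simp add: w_def)
  have w0: "w $ b = 0" if "b < ?N" "b \<noteq> 0" for b
  proof -
    have "w $ b = (\<Sum>c<?N. v $ c * h c b)"
      using that v(1) by (simp add: w_def H_def scalar_prod_def lessThan_atLeast0 sym[of b] mult.commute)
    then show ?thesis using zero that by simp
  qed
  have v_eq: "v = H *\<^sub>v w"
    using v by (simp add: w_def HH assoc_mult_mat_vec[of H ?N ?N H ?N, symmetric])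
  have c0: "c \<noteq> 0"
  proof
    assume "c = 0"
    then have "w $ b = 0" if "b < ?N" for b using w0 that by (cases "b = 0") (auto simp: c_def)
    then have "w = 0\<^sub>v ?N" using w by (intro eq_vecI) auto
    then have "v = 0\<^sub>v ?N" unfolding v_eq by (intro eq_vecI) (auto simp: H_def)
    then show False using v by simp
  qed
  define B where "B = H * A * H"
  have B[simp]: "B \<in> carrier_mat ?N ?N" by (simp add: B_def)
  have BT: "transpose_mat B = B"
    by (simp add: B_def transpose_mult[of _ ?N ?N _ ?N] HT Suc.prems assoc)
  have "B *\<^sub>v w = e \<cdot>\<^sub>v w"
  proof -
    have "B *\<^sub>v w = H *\<^sub>v (A *\<^sub>v (H *\<^sub>v w))"
      by (simp add: B_def assoc_mult_mat_vec[of _ ?N ?N _ ?N])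
    also have "\<dots> = H *\<^sub>v (e \<cdot>\<^sub>v v)"
      by (simp only: v_eq[symmetric] v(3))
    also have "\<dots> = e \<cdot>\<^sub>v w"
      using v(1) by (simp add: mult_mat_vec[of _ ?N ?N] w_def)
    finally show ?thesis .
  qed
  then have "(B *\<^sub>v w) $ i = e * w $ i" if "i < ?N" for i
    using that w by (metis carrier_vecD index_smult_vec(1))
  moreover have "(B *\<^sub>v w) $ i = B $$ (i,0) * c" if "i < ?N" for i
  proof -
    have "(B *\<^sub>v w) $ i = (\<Sum>j<?N. B $$ (i,j) * w $ j)"
      using that carrier_matD[OF B]
      by (auto simp: carrier_vecD[OF w] scalar_prod_def lessThan_atLeast0 simp del: sum.op_ivl_Suc intro!: sum.cong)
    also have "\<dots> = B $$ (i,0) * w $ 0"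
      using w0 by (subst sum.lessThan_Suc_shift) simp
    finally show ?thesis by (simp add: c_def)
  qed
  ultimately have Bc: "B $$ (i,0) * c = e * w $ i" if "i < ?N" for i
    using that by simp
  \<comment> \<open>Dividing the eigenvector equation for \<open>w\<close> by \<open>c\<close> gives
    the first column of \<open>B\<close>; symmetry then gives the first row.\<close>
  have col0: "B $$ (i,0) = (if i = 0 then e else 0)" if "i < ?N" for i
    using Bc[OF that] w0[OF that] c0 by (cases "i = 0") (auto simp: c_def)
  have B_sym: "B $$ (i,j) = B $$ (j,i)" if "i < ?N" "j < ?N" for i j
    using that BT by (metis B carrier_matD index_transpose_mat(1))
  have row0: "B $$ (0,i) = (if i = 0 then e else 0)" if "i < ?N" for i
    using col0[OF that] B_sym[OF _ that, of 0] by simp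
  define C where "C = mat n n (\<lambda>(i,j). B $$ (Suc i, Suc j))"
  have C: "C \<in> carrier_mat n n" by (simp add: C_def)
  have "transpose_mat C = C"
    by (intro eq_matI) (auto simp: C_def B_sym)
  from Suc.IH[OF C this] obtain W d where W: "W \<in> carrier_mat n n" "transpose_mat W * W = 1\<^sub>m n"
    "C = W * mat_diag n d * transpose_mat W" by blast
  \<comment> \<open>The diagonalization of \<open>C\<close> is extended by a 1 in the corner, and
    \<open>H * U\<close> then diagonalizes \<open>A\<close>.\<close>
  define U where "U = four_block_mat (1\<^sub>m 1) (0\<^sub>m 1 n) (0\<^sub>m n 1) W"
  define D where "D = mat_diag ?N (case_nat e d)"
  have D: "D = four_block_mat (mat 1 1 (\<lambda>_. e)) (0\<^sub>m 1 n) (0\<^sub>m n 1) (mat_diag n d)"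
    by (intro eq_matI) (auto simp: D_def mat_diag_def split: nat.splits)
  have U[simp]: "U \<in> carrier_mat ?N ?N" using W by (auto simp: U_def)
  have D'[simp]: "D \<in> carrier_mat ?N ?N" by (simp add: D_def)
  have UT: "transpose_mat U = four_block_mat (1\<^sub>m 1) (0\<^sub>m 1 n) (0\<^sub>m n 1) (transpose_mat W)"
    unfolding U_def using W by (subst transpose_four_block_mat[of _ 1 1 _ n _ n]) auto
  have UU: "transpose_mat U * U = 1\<^sub>m ?N"
    unfolding UT unfolding U_def using W
    by (subst mult_four_block_mat[of _ 1 1 _ n _ n _ _ 1 _ n])
      (auto intro!: eq_matI)
  have "U * D = four_block_mat (mat 1 1 (\<lambda>_. e)) (0\<^sub>m 1 n) (0\<^sub>m n 1) (W * mat_diag n d)"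
    unfolding U_def D using W
    by (subst mult_four_block_mat[of _ 1 1 _ n _ n _ _ 1 _ n]) (auto simp: left_mult_zero_mat[of _ n n])
  then have "U * D * transpose_mat U = four_block_mat (mat 1 1 (\<lambda>_. e)) (0\<^sub>m 1 n) (0\<^sub>m n 1) C"
    unfolding UT using W
    by (simp, subst mult_four_block_mat[of _ 1 1 _ n _ n _ _ 1 _ n])
       (auto simp: mult_carrier_mat[of _ n n _ n] left_mult_zero_mat[of _ n n] right_mult_zero_mat[of _ n n])
  also have "\<dots> = B"
    by (intro eq_matI) (auto simp: C_def col0 row0 carrier_matD[OF B])
  finally have BU: "U * D * transpose_mat U = B" .
  have "(H * U) * D * transpose_mat (H * U) = H * (U * D * transpose_mat U) * H"
    by (simp add: transpose_mult[of _ ?N ?N _ ?N] HT assoc)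
  also have "\<dots> = A"
    unfolding BU B_def
    by (simp add: assoc mult_mat_mult_cancel_left[OF HH H H, of _ ?N] HH right_mult_one_mat[of _ ?N ?N])
  finally have 1: "A = (H * U) * D * transpose_mat (H * U)" ..
  have "transpose_mat (H * U) * (H * U) = 1\<^sub>m ?N"
    by (simp add: transpose_mult[of _ ?N ?N _ ?N] HT assoc mult_mat_mult_cancel_left[OF HH H H, of _ ?N] UU)
  with 1 show ?case unfolding D_def by (intro exI[of _ "H * U"] exI[of _ "case_nat e d"]) auto
qed

lemma index_mult_mat_diag_mult:
  assumes "X \<in> carrier_mat nr n" "Y \<in> carrier_mat n nc" "i < nr" "j < nc"
  shows "(X * mat_diag n d * Y) $$ (i,j) = (\<Sum>k<n. X $$ (i,k) * d k * Y $$ (k,j))"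
  using assms by (simp add: mat_diag_mult_right[of _ nr n] scalar_prod_def lessThan_atLeast0)

text \<open>The columns of \<open>W\<close> are permuted along with the eigenvalues. Sortedness is
  what later identifies \<open>d\<close> entry by entry with \<open>eigenvalue_vec\<close>.\<close>

lemma symmetric_mat_diagonalizable_sorted:
  fixes A :: "real mat"
  assumes A: "A \<in> carrier_mat n n" "transpose_mat A = A"
  obtains W d where "W \<in> carrier_mat n n" "transpose_mat W * W = 1\<^sub>m n"
    "A = W * mat_diag n d * transpose_mat W" "mono_on {..<n} d"
proof -
  obtain V c where V: "V \<in> carrier_mat n n" "transpose_mat V * V = 1\<^sub>m n"
    "A = V * mat_diag n c * transpose_mat V"
    using symmetric_mat_diagonalizable[OF A] by blast
  define cs where "cs = map c [0..<n]"
  have "mset (sort cs) = mset cs" by simp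
  then obtain p where p: "p permutes {..<length cs}" "permute_list p cs = sort cs"
    by (rule mset_eq_permutation)
  have len: "length cs = n" by (simp add: cs_def)
  have p': "p permutes {..<n}" using p len by simp
  have pn: "p i < n" if "i < n" for i
    using permutes_in_image[OF p', of i] that by simp
  have pinj: "p i = p j \<longleftrightarrow> i = j" for i j
    using permutes_inj[OF p'] by (auto dest: injD)
  define d where "d = c \<circ> p"
  have srt: "d i = sort cs ! i" if "i < n" for i
    using permute_list_nth[OF p(1), of i] that pn len p(2) by (simp add: d_def cs_def)
  define W where "W = mat n n (\<lambda>(i,j). V $$ (i, p j))"
  have W: "W \<in> carrier_mat n n" by (simp add: W_def)
  have "transpose_mat W * W = 1\<^sub>m n"
  proof (intro eq_matI)
    fix i j assume "i < dim_row (1\<^sub>m n :: real mat)" "j < dim_col (1\<^sub>m n :: real mat)"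
    then have ij: "i < n" "j < n" by auto
    then have "(transpose_mat W * W) $$ (i,j) = (transpose_mat V * V) $$ (p i, p j)"
      using V(1) pn by (simp add: W_def scalar_prod_def)
    with ij pn pinj show "(transpose_mat W * W) $$ (i,j) = (1\<^sub>m n :: real mat) $$ (i,j)"
      by (simp add: V(2))
  qed (auto simp: W_def)
  moreover have "A = W * mat_diag n d * transpose_mat W"
  proof (intro eq_matI)
    fix i j assume "i < dim_row (W * mat_diag n d * transpose_mat W)"
      "j < dim_col (W * mat_diag n d * transpose_mat W)"
    then have ij: "i < n" "j < n" using W by auto
    have "A $$ (i,j) = (\<Sum>k<n. V $$ (i,k) * c k * V $$ (j,k))"
      unfolding V(3) using ij V(1) by (subst index_mult_mat_diag_mult) auto
    also have "\<dots> = (\<Sum>k<n. V $$ (i,p k) * c (p k) * V $$ (j,p k))"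
      using sum.permute[OF p', of "\<lambda>k. V $$ (i,k) * c k * V $$ (j,k)"] by (simp add: o_def)
    also have "\<dots> = (W * mat_diag n d * transpose_mat W) $$ (i,j)"
      using ij W by (subst index_mult_mat_diag_mult) (auto simp: W_def d_def)
    finally show "A $$ (i,j) = (W * mat_diag n d * transpose_mat W) $$ (i,j)" .
  qed (use W A in auto)
  moreover have "mono_on {..<n} d"
    by (intro mono_onI) (auto simp: srt len intro!: sorted_nth_mono)
  ultimately show ?thesis using that[OF W] by blast
qed

section \<open>Eigenvalue vectors of orthogonally diagonalized matrices\<close>

lemma proots_prod_linear_factors:
  "proots (\<Prod>a\<leftarrow>as. [:- a, 1:]) = mset (as :: 'a :: idom list)"
proof (induction as)
  case (Cons a as)
  have "(\<Prod>a\<leftarrow>as. [:- a, 1:]) \<noteq> 0" by (auto simp: prod_list_zero_iff)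
  then have "proots ([:- a, 1:] * (\<Prod>a\<leftarrow>as. [:- a, 1:])) = {#a#} + mset as"
    by (subst proots_mult) (auto simp: Cons)
  then show ?case by simp
qed simp

text \<open>Similarity to \<open>mat_diag n d\<close> makes the characteristic polynomial a product
  of linear factors with roots \<open>d i\<close>; since \<open>d\<close> is monotone, sorting these
  roots changes nothing.\<close>

lemma eigenvalue_vec_diagonalized:
  assumes W: "W \<in> carrier_mat n n" "transpose_mat W * W = 1\<^sub>m n"
    and sorted: "mono_on {..<n} d"
  shows "eigenvalue_vec (W * mat_diag n d * transpose_mat W) = vec n d"
proof -
  let ?D = "mat_diag n d" and ?ds = "map d [0..<n]"
  have WW: "W * transpose_mat W = 1\<^sub>m n"
    using mat_mult_left_right_inverse[OF _ W(1,2)] W(1) by simp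
  have "similar_mat_wit (W * ?D * transpose_mat W) ?D W (transpose_mat W)"
    using W WW by (intro similar_mat_witI[of _ _ n]) auto
  then have "char_poly (W * ?D * transpose_mat W) = char_poly ?D"
    by (intro char_poly_similar) (auto simp: similar_mat_def)
  also have "\<dots> = (\<Prod>a\<leftarrow>diag_mat ?D. [:- a, 1:])"
    by (rule char_poly_upper_triangular[of _ n]) (auto simp: mat_diag_def)
  also have "diag_mat ?D = ?ds"
    by (auto simp: diag_mat_def mat_diag_def)
  finally have "proots (char_poly (W * ?D * transpose_mat W)) = mset ?ds"
    by (simp only: proots_prod_linear_factors)
  moreover have "sorted ?ds"
    using sorted by (auto simp: sorted_iff_nth_mono monotone_on_def)
  ultimately have "eigenvalue_vec (W * ?D * transpose_mat W) = vec_of_list ?ds"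
    unfolding eigenvalue_vec_def by (simp only: sorted_list_of_multiset_mset sorted_sort_id)
  also have "\<dots> = vec n d"
    by (intro eq_vecI) (auto simp: vec_of_list_index simp del: vec_of_list_map)
  finally show ?thesis .
qed

subsection \<open>Positive definite matrices and their square roots\<close>

lemma positive_definite_carrier:
  "positive_definite P \<Longrightarrow> P \<in> carrier_mat (dim_row P) (dim_row P)"
  unfolding positive_definite_def by (metis carrier_matI index_transpose_mat(3))

lemma positive_definiteD:
  assumes "positive_definite P" "P \<in> carrier_mat n n"
  shows "transpose_mat P = P" "v \<in> carrier_vec n \<Longrightarrow> v \<noteq> 0\<^sub>v n \<Longrightarrow> 0 < v \<bullet> (P *\<^sub>v v)"
  using assms by (auto simp: positive_definite_def)

text \<open>The form of the new matrix at \<open>v\<close> is the form of \<open>P\<close> at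
  \<open>X v\<close>, and the left inverse \<open>Y\<close> keeps \<open>X v\<close>
  nonzero.\<close>

lemma positive_definite_congruence:
  assumes P: "positive_definite P" "P \<in> carrier_mat n n"
    and X: "X \<in> carrier_mat n n" and Y: "Y \<in> carrier_mat n n" "Y * X = 1\<^sub>m n"
  shows "positive_definite (transpose_mat X * P * X)"
proof -
  note [simp] = mult_carrier_mat[of _ n n _ n] mult_mat_vec_carrier[of _ n n]
  have T: "transpose_mat (transpose_mat X * P * X) = transpose_mat X * P * X"
    using X P by (simp add: transpose_mult[of _ n n _ n] positive_definiteD(1)[OF P]
        assoc_mult_mat[of _ n n _ n _ n])
  have "0 < v \<bullet> ((transpose_mat X * P * X) *\<^sub>v v)" if v: "v \<in> carrier_vec n" "v \<noteq> 0\<^sub>v n" for v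
  proof -
    have "X *\<^sub>v v \<noteq> 0\<^sub>v n"
    proof
      assume "X *\<^sub>v v = 0\<^sub>v n"
      then have "(Y * X) *\<^sub>v v = Y *\<^sub>v 0\<^sub>v n"
        using assoc_mult_mat_vec[OF Y(1) X v(1)] by simp
      also have "\<dots> = 0\<^sub>v n" using Y by auto
      finally show False using v by (simp add: Y(2))
    qed
    then have "0 < (X *\<^sub>v v) \<bullet> (P *\<^sub>v (X *\<^sub>v v))"
      using positive_definiteD(2)[OF P, of "X *\<^sub>v v"] X v by simp
    also have "\<dots> = v \<bullet> (transpose_mat X *\<^sub>v (P *\<^sub>v (X *\<^sub>v v)))"
      using transpose_vec_mult_scalar[of "X" n n v "P *\<^sub>v (X *\<^sub>v v)"] X P v
      by (simp add: comm_scalar_prod[of _ n])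
    also have "\<dots> = v \<bullet> ((transpose_mat X * P * X) *\<^sub>v v)"
      using X P v by (simp add: assoc_mult_mat_vec[of _ n n _ n])
    finally show ?thesis .
  qed
  then show ?thesis using T X unfolding positive_definite_def by auto
qed

lemma positive_definite_mat_diag:
  assumes "\<forall>i<n. 0 < d i"
  shows "positive_definite (mat_diag n d)"
  unfolding positive_definite_def
proof (intro conjI ballI impI)
  show "transpose_mat (mat_diag n d) = mat_diag n d"
    by (intro eq_matI) (auto simp: mat_diag_def)
next
  fix v :: "real vec" assume "v \<in> carrier_vec (dim_row (mat_diag n d))" "v \<noteq> 0\<^sub>v (dim_row (mat_diag n d))"
  then have v: "v \<in> carrier_vec n" "v \<noteq> 0\<^sub>v n" by (auto simp: mat_diag_def)
  then obtain i where i: "i < n" "v $ i \<noteq> 0"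
    by (metis carrier_vecD eq_vecI index_zero_vec)
  have "mat_diag n d *\<^sub>v v = vec n (\<lambda>i. d i * v $ i)"
  proof (intro eq_vecI)
    fix i assume "i < dim_vec (vec n (\<lambda>i. d i * v $ i))"
    then have i: "i < n" by simp
    then have "(mat_diag n d *\<^sub>v v) $ i = (\<Sum>j=0..<n. (if i = j then d j else 0) * v $ j)"
      using v(1) by (simp add: mat_diag_def scalar_prod_def)
    also have "\<dots> = (\<Sum>j=0..<n. if j = i then d j * v $ j else 0)"
      by (intro sum.cong) auto
    finally show "(mat_diag n d *\<^sub>v v) $ i = vec n (\<lambda>i. d i * v $ i) $ i" using i by simp
  qed (simp add: mat_diag_def)
  then have "v \<bullet> (mat_diag n d *\<^sub>v v) = (\<Sum>i<n. d i * (v $ i)\<^sup>2)"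
    using v by (simp add: scalar_prod_def lessThan_atLeast0 power2_eq_square mult.left_commute)
  also have "\<dots> > 0"
    using i assms by (intro sum_pos2[of _ i]) (auto simp: less_imp_le)
  finally show "0 < v \<bullet> (mat_diag n d *\<^sub>v v)" .
qed

lemma positive_definite_diagonalized:
  assumes W: "W \<in> carrier_mat n n" "transpose_mat W * W = 1\<^sub>m n"
    and d: "\<forall>i<n. 0 < d i"
  shows "positive_definite (W * mat_diag n d * transpose_mat W)"
proof -
  have WW: "W * transpose_mat W = 1\<^sub>m n"
    using mat_mult_left_right_inverse[OF _ W(1,2)] W(1) by simp
  then show ?thesis
    using positive_definite_congruence[OF positive_definite_mat_diag[OF d] mat_diag_dim, where X = "transpose_mat W" and Y = W] W
    by simp
qed

text \<open>Column \<open>k\<close> of the identity \<open>?P * W = W * mat_diag n d\<close>,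
  together with the diagonal of \<open>transpose_mat W * W\<close>.\<close>

lemma diagonalized_mult_vec_col:
  fixes W :: "real mat"
  assumes W: "W \<in> carrier_mat n n" "transpose_mat W * W = 1\<^sub>m n" and k: "k < n"
  shows "(W * mat_diag n d * transpose_mat W) *\<^sub>v col W k = d k \<cdot>\<^sub>v col W k" (is "?P *\<^sub>v _ = _")
    and "col W k \<bullet> col W k = 1" and "col W k \<noteq> 0\<^sub>v n"
proof -
  note [simp] = mult_carrier_mat[of _ n n _ n]
  have "?P * W = W * mat_diag n d"
    using W by (simp add: assoc_mult_mat[of _ n n _ n _ n] right_mult_one_mat[of _ n n])
  then have "col (?P * W) k = col (W * mat_diag n d) k" by simp
  moreover have "col (?P * W) k = ?P *\<^sub>v col W k"
    using W k by (intro col_mult2[of _ n n]) auto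
  moreover have "col (W * mat_diag n d) k = d k \<cdot>\<^sub>v col W k"
    using W k by (intro eq_vecI) (auto simp: mat_diag_mult_right[of _ n n] mult.commute)
  ultimately show "?P *\<^sub>v col W k = d k \<cdot>\<^sub>v col W k" by simp
  have "(transpose_mat W * W) $$ (k,k) = col W k \<bullet> col W k"
    using W(1) k by simp
  then show 1: "col W k \<bullet> col W k = 1" using W(2) k by simp
  then show "col W k \<noteq> 0\<^sub>v n" by auto
qed

text \<open>Each \<open>d k\<close> is the value of the quadratic form of \<open>P\<close> at the
  unit eigenvector \<open>col W k\<close>, hence positive.\<close>

lemma positive_definite_diagonalizable:
  assumes P: "positive_definite P" "P \<in> carrier_mat n n"
  obtains W d where "W \<in> carrier_mat n n" "transpose_mat W * W = 1\<^sub>m n"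
    "P = W * mat_diag n d * transpose_mat W" "mono_on {..<n} d"
    "\<forall>i<n. 0 < d i"
proof -
  obtain W d where W: "W \<in> carrier_mat n n" "transpose_mat W * W = 1\<^sub>m n"
    and eq: "P = W * mat_diag n d * transpose_mat W" and "mono_on {..<n} d"
    by (rule symmetric_mat_diagonalizable_sorted[OF P(2) positive_definiteD(1)[OF P]])
  moreover have "\<forall>i<n. 0 < d i"
  proof (intro allI impI)
    fix k assume k: "k < n"
    note w = diagonalized_mult_vec_col[OF W k]
    have "col W k \<in> carrier_vec n" using W k by simp
    then have "0 < col W k \<bullet> (P *\<^sub>v col W k)"
      using positive_definiteD(2)[OF P] w(3) by blast
    also have "\<dots> = d k"
      unfolding eq w(1) using w(2) W(1) k by simp
    finally show "0 < d k" .
  qed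
  ultimately show ?thesis using that by blast
qed

section \<open>Uniqueness and computation of square roots\<close>

text \<open>If \<open>B\<^sup>2 = C\<^sup>2\<close> and \<open>X = B - C\<close>, then \<open>B X + X C = 0\<close>; pairing this with an eigenvector \<open>v\<close>
  of \<open>X\<close> for the eigenvalue \<open>x\<close> gives \<open>x (v \<bullet> B v + v \<bullet> C v) = 0\<close>, so \<open>x = 0\<close>.\<close>
lemma positive_definite_sqrt_unique:
  assumes B: "positive_definite B" "B \<in> carrier_mat n n"
    and C: "positive_definite C" "C \<in> carrier_mat n n"
    and eq: "B * B = C * C"
  shows "B = C"
proof -
  note [simp] = mult_carrier_mat[of _ n n _ n] mult_mat_vec_carrier[of _ n n] minus_carrier_mat
  define X where "X = B - C"
  have X: "X \<in> carrier_mat n n" using B C by (simp add: X_def minus_carrier_mat)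
  have XT: "transpose_mat X = X"
    unfolding X_def using B C positive_definiteD(1)[OF B] positive_definiteD(1)[OF C]
    by (metis transpose_minus)
  obtain W x where W: "W \<in> carrier_mat n n" "transpose_mat W * W = 1\<^sub>m n"
    and Xeq: "X = W * mat_diag n x * transpose_mat W"
    using symmetric_mat_diagonalizable[OF X XT] by blast
  have BX: "B * X = B * B - B * C" unfolding X_def using B C by (simp add: mult_minus_distrib_mat[of _ n n])
  have XC: "X * C = B * C - C * C" unfolding X_def using B C by (simp add: minus_mult_distrib_mat[of _ n n])
  have x0: "x k = 0" if k: "k < n" for k
  proof -
    define v where "v = col W k"
    have v: "v \<in> carrier_vec n" using W k by (simp add: v_def)
    have Xv: "X *\<^sub>v v = x k \<cdot>\<^sub>v v"
      unfolding Xeq v_def by (rule diagonalized_mult_vec_col(1)[OF W k])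
    have v0: "v \<noteq> 0\<^sub>v n" unfolding v_def by (rule diagonalized_mult_vec_col(3)[OF W k])
    have "B * X + X * C = 0\<^sub>m n n"
      unfolding BX XC eq using B C by (intro eq_matI) auto
    then have "(B * X + X * C) *\<^sub>v v = 0\<^sub>v n" using v by (auto simp: scalar_prod_def)
    then have "B *\<^sub>v (X *\<^sub>v v) + X *\<^sub>v (C *\<^sub>v v) = 0\<^sub>v n"
      using B(2) C(2) X v by (simp add: add_mult_distrib_mat_vec[of _ n n] assoc_mult_mat_vec[of _ n n _ n])
    then have "v \<bullet> (B *\<^sub>v (X *\<^sub>v v) + X *\<^sub>v (C *\<^sub>v v)) = 0" using v by simp
    moreover have "v \<bullet> (X *\<^sub>v (C *\<^sub>v v)) = (X *\<^sub>v v) \<bullet> (C *\<^sub>v v)"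
      using transpose_vec_mult_scalar[of X n n "C *\<^sub>v v" v] X C v XT by simp
    ultimately have "x k * (v \<bullet> (B *\<^sub>v v) + v \<bullet> (C *\<^sub>v v)) = 0"
      using B(2) C(2) X v
      by (simp add: scalar_prod_add_distrib[of _ n] Xv mult_mat_vec[of _ n n] algebra_simps)
    moreover have "0 < v \<bullet> (B *\<^sub>v v)" "0 < v \<bullet> (C *\<^sub>v v)"
      using positive_definiteD(2)[OF B v v0] positive_definiteD(2)[OF C v v0] by auto
    ultimately show ?thesis by simp
  qed
  have X0: "X $$ (i,j) = 0" if "i < n" "j < n" for i j
    unfolding Xeq using that W(1) x0 by (subst index_mult_mat_diag_mult) auto
  show ?thesis
  proof (intro eq_matI)
    fix i j assume "i < dim_row C" "j < dim_col C"
    then show "B $$ (i,j) = C $$ (i,j)" using X0[of i j] B C by (simp add: X_def)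
  qed (use B C in auto)
qed

text \<open>Uniqueness of the root turns the definite description into an ordinary equation.\<close>

lemma mat_sqrt_eqI:
  assumes B: "positive_definite B" and eq: "B * B = P"
  shows "mat_sqrt P = B"
  unfolding mat_sqrt_def
proof (rule the_equality)
  fix C assume "positive_definite C \<and> C * C = P"
  then have C: "positive_definite C" "C * C = B * B" by (simp_all only: eq)
  \<comment> \<open>The description does not fix the size of its candidates; it is recovered from
    the equality of the squares.\<close>
  have "dim_row C = dim_row B"
    using arg_cong[OF C(2), of dim_row] by (simp only: index_mult_mat)
  with positive_definite_carrier[OF C(1)] have "C \<in> carrier_mat (dim_row B) (dim_row B)"
    by (simp only:)
  then show "C = B"
    by (rule positive_definite_sqrt_unique[OF C(1) _ B positive_definite_carrier[OF B] C(2)])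
qed (simp only: assms simp_thms)

lemma mult_diagonalized:
  fixes W :: "real mat"
  assumes W: "W \<in> carrier_mat n n" "transpose_mat W * W = 1\<^sub>m n"
  shows "(W * mat_diag n c * transpose_mat W) * (W * mat_diag n d * transpose_mat W)
    = W * mat_diag n (\<lambda>i. c i * d i) * transpose_mat W"
proof -
  note [simp] = mult_carrier_mat[of _ n n _ n]
  have "(W * mat_diag n c * transpose_mat W) * (W * mat_diag n d * transpose_mat W)
    = W * (mat_diag n c * mat_diag n d) * transpose_mat W"
    using W by (simp add: assoc_mult_mat[of _ n n _ n _ n] mult_mat_mult_cancel_left[of "transpose_mat W" W n n _ n] del: mat_diag_diag)
  then show ?thesis by simp
qed

lemma mat_sqrt_diagonalized:
  assumes W: "W \<in> carrier_mat n n" "transpose_mat W * W = 1\<^sub>m n"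
    and d: "\<forall>i<n. 0 < d i"
  shows "mat_sqrt (W * mat_diag n (\<lambda>i. d i * d i) * transpose_mat W) = W * mat_diag n d * transpose_mat W"
  by (rule mat_sqrt_eqI[OF positive_definite_diagonalized[OF W d] mult_diagonalized[OF W]])

text \<open>Writing the eigenvalues as squares exhibits \<open>P\<close> and its root in the same
  eigenbasis \<open>W\<close>.\<close>

lemma positive_definite_diagonalizable_square:
  assumes P: "positive_definite P" "P \<in> carrier_mat n n"
  obtains W d where "W \<in> carrier_mat n n" "transpose_mat W * W = 1\<^sub>m n"
    "P = W * mat_diag n (\<lambda>i. d i * d i) * transpose_mat W"
    "mat_sqrt P = W * mat_diag n d * transpose_mat W"
    "mono_on {..<n} d" "\<forall>i<n. 0 < d i"
proof -
  obtain W c where W: "W \<in> carrier_mat n n" "transpose_mat W * W = 1\<^sub>m n"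
    and eq: "P = W * mat_diag n c * transpose_mat W" and c: "mono_on {..<n} c"
      "\<forall>i<n. 0 < c i"
    by (rule positive_definite_diagonalizable[OF P])
  define d where "d i = sqrt (c i)" for i
  have d: "\<forall>i<n. 0 < d i" using c(2) by (simp add: d_def)
  have "mat_diag n c = mat_diag n (\<lambda>i. d i * d i)"
    using c(2) by (intro eq_matI) (auto simp: mat_diag_def d_def less_imp_le)
  then have eq': "P = W * mat_diag n (\<lambda>i. d i * d i) * transpose_mat W" using eq by simp
  have root: "mat_sqrt P = W * mat_diag n d * transpose_mat W"
    unfolding eq' by (rule mat_sqrt_diagonalized[OF W d])
  show ?thesis
    by (rule that[OF W eq' root _ d]) (use c(1) in \<open>auto simp: d_def monotone_on_def\<close>)
qed

lemma mat_sqrt_positive_definite: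
  assumes P: "positive_definite P" "P \<in> carrier_mat n n"
  shows "positive_definite (mat_sqrt P)" "mat_sqrt P \<in> carrier_mat n n" "mat_sqrt P * mat_sqrt P = P"
proof -
  obtain W d where W: "W \<in> carrier_mat n n" "transpose_mat W * W = 1\<^sub>m n"
    and eq: "P = W * mat_diag n (\<lambda>i. d i * d i) * transpose_mat W"
    and root: "mat_sqrt P = W * mat_diag n d * transpose_mat W"
      "mono_on {..<n} d" and d: "\<forall>i<n. 0 < d i"
    by (rule positive_definite_diagonalizable_square[OF P])
  show "positive_definite (mat_sqrt P)"
    unfolding root by (rule positive_definite_diagonalized[OF W d])
  show "mat_sqrt P \<in> carrier_mat n n"
    unfolding root using W by (simp add: mult_carrier_mat[of _ n n _ n])
  show "mat_sqrt P * mat_sqrt P = P"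
    unfolding root by (simp only: mult_diagonalized[OF W] eq)
qed

subsection \<open>The extremal principle\<close>

text \<open>With \<open>R\<close> the root of \<open>G\<close>, diagonalize
  \<open>M = R * E * R\<close> by \<open>W\<close> with eigenvalues \<open>d i * d i\<close>. Then
  \<open>T = R * (W * K)\<close> and \<open>S = Q * (W * L)\<close>, where \<open>Q\<close> inverts
  \<open>R\<close>, \<open>L\<close> is the root of \<open>mat_diag n d\<close> and \<open>K\<close>
  inverts \<open>L\<close>. In both congruences the factors \<open>R\<close> and \<open>Q\<close>
  either cancel or assemble to \<open>M\<close>, leaving \<open>mat_diag n d\<close>.\<close>

lemma simultaneous_diagonalization:
  assumes E: "positive_definite E" "E \<in> carrier_mat n n"
    and G: "positive_definite G" "G \<in> carrier_mat n n"
  obtains T S d where "T \<in> carrier_mat n n" "S \<in> carrier_mat n n"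
    "transpose_mat T * S = 1\<^sub>m n"
    "transpose_mat T * E * T = mat_diag n d" "transpose_mat S * G * S = mat_diag n d"
    "mono_on {..<n} d" "\<forall>i<n. 0 < d i"
    "eigenvalue_vec (mat_sqrt (mat_sqrt G * E * mat_sqrt G)) = vec n d"
proof -
  note [simp] = mult_carrier_mat[of _ n n _ n]
  note assoc = assoc_mult_mat[of _ n n _ n _ n] right_mult_one_mat[of _ n n] left_mult_one_mat[of _ n n]
  obtain V c where V: "V \<in> carrier_mat n n" "transpose_mat V * V = 1\<^sub>m n"
    and G_eq: "G = V * mat_diag n (\<lambda>i. c i * c i) * transpose_mat V"
    and R_eq: "mat_sqrt G = V * mat_diag n c * transpose_mat V"
    and "mono_on {..<n} c" and c: "\<forall>i<n. 0 < c i"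
    by (rule positive_definite_diagonalizable_square[OF G])
  have VV: "V * transpose_mat V = 1\<^sub>m n"
    using mat_mult_left_right_inverse[OF _ V(1,2)] V(1) by simp
  have diag_one: "mat_diag n f = 1\<^sub>m n" if "\<And>i. i < n \<Longrightarrow> f i = 1" for f :: "nat \<Rightarrow> real"
    using that by (intro eq_matI) (auto simp: mat_diag_def)
  have diag_T: "transpose_mat (mat_diag n f) = mat_diag n f" for f :: "nat \<Rightarrow> real"
    by (intro eq_matI) (auto simp: mat_diag_def)
  define R where "R = mat_sqrt G"
  \<comment> \<open>The inverse of \<open>R\<close>, obtained by inverting its eigenvalues in the
    same basis \<open>V\<close>.\<close>
  define Q where "Q = V * mat_diag n (\<lambda>i. 1 / c i) * transpose_mat V"
  have R: "R \<in> carrier_mat n n" "R * R = G" "positive_definite R"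
    unfolding R_def using mat_sqrt_positive_definite[OF G] by auto
  have RT: "transpose_mat R = R" using positive_definiteD(1)[OF R(3,1)] .
  have Q: "Q \<in> carrier_mat n n" using V by (simp add: Q_def)
  have QT: "transpose_mat Q = Q"
    unfolding Q_def using V(1) by (simp add: transpose_mult[of _ n n _ n] diag_T assoc)
  have RQ: "R * Q = 1\<^sub>m n"
  proof -
    have "R * Q = V * mat_diag n (\<lambda>i. c i * (1 / c i)) * transpose_mat V"
      unfolding R_def R_eq Q_def by (rule mult_diagonalized[OF V])
    also have "mat_diag n (\<lambda>i. c i * (1 / c i)) = 1\<^sub>m n"
      using c by (intro diag_one) (simp add: less_imp_neq[symmetric])
    finally show ?thesis using V(1) VV by (simp add: assoc)
  qed
  then have QR: "Q * R = 1\<^sub>m n"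
    by (rule mat_mult_left_right_inverse[OF R(1) Q])
  define M where "M = R * E * R"
  have M: "positive_definite M" "M \<in> carrier_mat n n"
    using positive_definite_congruence[OF E R(1) Q QR] E(2) R(1) by (auto simp: M_def RT)
  obtain W d where W: "W \<in> carrier_mat n n" "transpose_mat W * W = 1\<^sub>m n"
    and M_eq: "M = W * mat_diag n (\<lambda>i. d i * d i) * transpose_mat W"
    and M_root: "mat_sqrt M = W * mat_diag n d * transpose_mat W"
    and mono: "mono_on {..<n} d" and d: "\<forall>i<n. 0 < d i"
    by (rule positive_definite_diagonalizable_square[OF M])
  define K where "K = mat_diag n (\<lambda>i. 1 / sqrt (d i))"
  define L where "L = mat_diag n (\<lambda>i. sqrt (d i))"
  have KL: "K \<in> carrier_mat n n" "L \<in> carrier_mat n n"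
    "transpose_mat K = K" "transpose_mat L = L"
    by (simp_all add: K_def L_def diag_T)
  have KL1: "K * L = 1\<^sub>m n"
    unfolding K_def L_def mat_diag_diag using d by (intro diag_one) (auto simp: less_imp_neq[symmetric])
  have LL: "L * L = mat_diag n d"
    unfolding L_def mat_diag_diag using d by (intro eq_matI) (auto simp: mat_diag_def less_imp_le)
  have KDK: "K * (mat_diag n (\<lambda>i. d i * d i) * K) = mat_diag n d"
    unfolding K_def mat_diag_diag using d
    by (intro eq_matI) (auto simp: mat_diag_def less_imp_le real_div_sqrt field_simps)
  note cancelW = mult_mat_mult_cancel_left[OF W(2) _ W(1), of _ n]
  note cancelRQ = mult_mat_mult_cancel_left[OF RQ R(1) Q, of _ n]
  note cancelQR = mult_mat_mult_cancel_left[OF QR Q R(1), of _ n]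
  define T where "T = R * (W * K)"
  define S where "S = Q * (W * L)"
  have WT: "transpose_mat W \<in> carrier_mat n n" using W by simp
  have TS: "T \<in> carrier_mat n n" "S \<in> carrier_mat n n"
    using W KL R Q by (auto simp: T_def S_def)
  have TT: "transpose_mat T = K * (transpose_mat W * R)"
    unfolding T_def using W KL R(1) WT by (simp add: transpose_mult[of _ n n _ n] RT assoc)
  have ST: "transpose_mat S = L * (transpose_mat W * Q)"
    unfolding S_def using W KL Q WT by (simp add: transpose_mult[of _ n n _ n] QT assoc)
  have "transpose_mat T * S = 1\<^sub>m n"
    unfolding TT S_def using W KL R(1) Q WT
    by (simp add: assoc cancelRQ cancelW KL1)
  moreover have "transpose_mat T * E * T = mat_diag n d"
  proof -
    have "transpose_mat T * E * T = K * (transpose_mat W * M * W) * K"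
      unfolding TT unfolding T_def M_def using W KL R(1) WT E(2) by (simp add: assoc)
    also have "\<dots> = mat_diag n d"
      unfolding M_eq using W KL WT by (simp add: assoc cancelW KDK)
    finally show ?thesis .
  qed
  moreover have "transpose_mat S * G * S = mat_diag n d"
    unfolding ST unfolding S_def R(2)[symmetric] using W KL R(1) Q WT
    by (simp add: assoc cancelRQ cancelQR cancelW LL)
  moreover have "eigenvalue_vec (mat_sqrt (mat_sqrt G * E * mat_sqrt G)) = vec n d"
    using eigenvalue_vec_diagonalized[OF W mono] M_root by (simp only: M_def R_def)
  ultimately show ?thesis using that[OF TS] mono d by blast
qed

lemma index_congruence:
  fixes X E Y :: "real mat"
  assumes "X \<in> carrier_mat n k" "E \<in> carrier_mat n n" "Y \<in> carrier_mat n l" "a < k" "b < l"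
  shows "(transpose_mat X * E * Y) $$ (a,b) = (\<Sum>i<n. \<Sum>j<n. X $$ (i,a) * E $$ (i,j) * Y $$ (j,b))"
  using assms by (simp add: scalar_prod_def lessThan_atLeast0 sum_distrib_left mult.assoc)

lemma scalar_prod_mult_mat_vec_eq_sum:
  fixes E :: "real mat"
  assumes "v \<in> carrier_vec n" "E \<in> carrier_mat n n"
  shows "v \<bullet> (E *\<^sub>v v) = (\<Sum>i<n. \<Sum>j<n. v $ i * E $$ (i,j) * v $ j)"
  using assms by (simp add: scalar_prod_def lessThan_atLeast0 sum_distrib_left mult.assoc)

text \<open>The substitution \<open>X = T * X'\<close>, \<open>Y = S * Y'\<close> preserves
  biorthogonality because \<open>S * transpose_mat T\<close> is the identity, and it replaces both
  \<open>E\<close> and \<open>G\<close> by \<open>mat_diag n d\<close>. This reduces the bound to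
  the diagonal case.\<close>

lemma biorthogonal_trace_ge:
  fixes x y :: "nat \<Rightarrow> nat \<Rightarrow> real"
  assumes T: "T \<in> carrier_mat n n" and S: "S \<in> carrier_mat n n" and TS: "transpose_mat T * S = 1\<^sub>m n"
    and E: "E \<in> carrier_mat n n" "transpose_mat T * E * T = mat_diag n d"
    and G: "G \<in> carrier_mat n n" "transpose_mat S * G * S = mat_diag n d"
    and d: "mono_on {..<n} d" "\<forall>i<n. 0 < d i"
    and xy: "\<And>a b. a < l \<Longrightarrow> b < l \<Longrightarrow> (\<Sum>i<n. x i a * y i b) = of_bool (a = b)"
  shows "2 * (\<Sum>j<l. d j) \<le>
    (\<Sum>a<l. \<Sum>i<n. \<Sum>j<n. x i a * E $$ (i,j) * x j a + y i a * G $$ (i,j) * y j a)"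
proof -
  note [simp] = mult_carrier_mat[of _ n n _ n] mult_carrier_mat[of _ n n _ l] mult_carrier_mat[of _ l n _ n]
  have TT: "transpose_mat T \<in> carrier_mat n n" "transpose_mat S \<in> carrier_mat n n" using T S by auto
  have STt: "S * transpose_mat T = 1\<^sub>m n"
    using mat_mult_left_right_inverse[OF _ S TS] T by simp
  have "transpose_mat (S * transpose_mat T) = T * transpose_mat S"
    using T S TT by (simp add: transpose_mult[of _ n n _ n])
  then have TSt: "T * transpose_mat S = 1\<^sub>m n" by (simp add: STt)
  define X where "X = mat n l (\<lambda>(i,a). x i a)"
  define Y where "Y = mat n l (\<lambda>(i,a). y i a)"
  have XY: "X \<in> carrier_mat n l" "Y \<in> carrier_mat n l" by (auto simp: X_def Y_def)
  define X' where "X' = transpose_mat S * X"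
  define Y' where "Y' = transpose_mat T * Y"
  have X': "X' \<in> carrier_mat n l" "Y' \<in> carrier_mat n l" using XY TT by (auto simp: X'_def Y'_def)
  have X_eq: "X = T * X'"
    unfolding X'_def by (rule mult_mat_mult_cancel_left[OF TSt T TT(2) XY(1), symmetric])
  have Y_eq: "Y = S * Y'"
    unfolding Y'_def by (rule mult_mat_mult_cancel_left[OF STt S TT(1) XY(2), symmetric])
  have diag: "(transpose_mat Z * A * Z) $$ (a,a) = (\<Sum>i<n. d i * (Z' $$ (i,a))\<^sup>2)"
    if Z: "Z = U * Z'" "Z' \<in> carrier_mat n l" "U \<in> carrier_mat n n" "A \<in> carrier_mat n n"
      "transpose_mat U * A * U = mat_diag n d" "a < l" for Z Z' U A a
  proof -
    have *: "transpose_mat U \<in> carrier_mat n n" "transpose_mat Z' \<in> carrier_mat l n" using Z by auto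
    have "transpose_mat Z * A * Z = transpose_mat Z' * (transpose_mat U * A * U) * Z'"
      using Z(2-4) * unfolding Z(1)
      by (simp add: transpose_mult[of _ n n _ l] assoc_mult_mat[of _ l n _ n _ n]
          assoc_mult_mat[of _ l n _ n _ l] assoc_mult_mat[of _ n n _ n _ l] assoc_mult_mat[of _ n n _ n _ n])
    also have "\<dots> $$ (a,a) = (\<Sum>i<n. d i * (Z' $$ (i,a))\<^sup>2)"
      unfolding Z(5) using Z(2,6) *
      by (subst index_mult_mat_diag_mult[of _ l n _ l]) (auto simp: power2_eq_square ac_simps)
    finally show ?thesis .
  qed
  have "transpose_mat X' * Y' = transpose_mat X * Y"
  proof -
    have "transpose_mat X' = transpose_mat X * S"
      unfolding X'_def using XY TT S by (simp add: transpose_mult[of _ n n _ l])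
    then have "transpose_mat X' * Y' = transpose_mat X * (S * Y')"
      using XY S X' by (simp add: assoc_mult_mat[of _ l n _ n _ l])
    then show ?thesis unfolding Y_eq[symmetric] .
  qed
  then have bi: "(\<Sum>i\<in>{0..<n}. X' $$ (i,a) * Y' $$ (i,b)) = of_bool (a = b)" if "a < l" "b < l" for a b
  proof -
    have "(\<Sum>i\<in>{0..<n}. X' $$ (i,a) * Y' $$ (i,b)) = (transpose_mat X' * Y') $$ (a,b)"
      using that X' by (simp add: scalar_prod_def)
    also have "\<dots> = (transpose_mat X * Y) $$ (a,b)" by (simp only: \<open>transpose_mat X' * Y' = transpose_mat X * Y\<close>)
    also have "\<dots> = (\<Sum>i<n. x i a * y i b)"
      using that by (simp add: X_def Y_def scalar_prod_def lessThan_atLeast0)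
    finally show ?thesis using xy that by simp
  qed
  \<comment> \<open>The diagonal bound with no rows split off, that is, with
    \<open>k = 0\<close>.\<close>
  have "2 * (\<Sum>j<l. d (0 + j)) \<le> (\<Sum>i\<in>{0..<n}. d i * (\<Sum>a<l. (X' $$ (i,a))\<^sup>2 + (Y' $$ (i,a))\<^sup>2))"
    by (rule biorthogonal_weighted_sum_ge[OF _ _ bi])
      (use d in \<open>auto simp: monotone_on_def less_imp_le\<close>)
  also have "\<dots> = (\<Sum>a<l. (\<Sum>i<n. d i * (X' $$ (i,a))\<^sup>2) + (\<Sum>i<n. d i * (Y' $$ (i,a))\<^sup>2))"
    unfolding sum_distrib_left lessThan_atLeast0 sum.distrib[symmetric] distrib_left[symmetric]
    by (rule sum.swap)
  also have "\<dots> = (\<Sum>a<l. (transpose_mat X * E * X) $$ (a,a) + (transpose_mat Y * G * Y) $$ (a,a))"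
    using diag[OF X_eq X'(1) T E] diag[OF Y_eq X'(2) S G] by simp
  also have "\<dots> = (\<Sum>a<l. \<Sum>i<n. \<Sum>j<n. x i a * E $$ (i,j) * x j a + y i a * G $$ (i,j) * y j a)"
  proof (intro sum.cong refl)
    fix a assume "a \<in> {..<l}"
    then have a: "a < l" by simp
    have "(transpose_mat X * E * X) $$ (a,a) = (\<Sum>i<n. \<Sum>j<n. x i a * E $$ (i,j) * x j a)"
      by (subst index_congruence[OF XY(1) E(1) XY(1) a a]) (auto simp: X_def a intro!: sum.cong)
    moreover have "(transpose_mat Y * G * Y) $$ (a,a) = (\<Sum>i<n. \<Sum>j<n. y i a * G $$ (i,j) * y j a)"
      by (subst index_congruence[OF XY(2) G(1) XY(2) a a]) (auto simp: Y_def a intro!: sum.cong)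
    ultimately show "(transpose_mat X * E * X) $$ (a,a) + (transpose_mat Y * G * Y) $$ (a,a)
      = (\<Sum>i<n. \<Sum>j<n. x i a * E $$ (i,j) * x j a + y i a * G $$ (i,j) * y j a)"
      by (simp add: sum.distrib)
  qed
  finally show ?thesis by simp
qed

subsection \<open>Pinching\<close>

text \<open>Indices are added one at a time. The new sign \<open>e\<close> is chosen against the
  total interaction \<open>t\<close> with the earlier indices, so the cross terms add
  \<open>e * t\<close>, which is nonpositive; diagonal terms are insensitive to signs.\<close>

lemma exists_signs_le_diagonal:
  fixes M :: "'a \<Rightarrow> 'a \<Rightarrow> real"
  assumes "finite I"
  shows "\<exists>s. (\<forall>a. s a * s a = 1) \<and> (\<Sum>a\<in>I. \<Sum>b\<in>I. s a * s b * M a b) \<le> (\<Sum>a\<in>I. M a a)"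
  using assms
proof (induction I)
  case empty
  then show ?case by (intro exI[of _ "\<lambda>_. 1"]) simp
next
  case (insert c I)
  then obtain s :: "'a \<Rightarrow> real" where s: "\<And>a. s a * s a = 1"
    and le: "(\<Sum>a\<in>I. \<Sum>b\<in>I. s a * s b * M a b) \<le> (\<Sum>a\<in>I. M a a)" by auto
  define t where "t = (\<Sum>a\<in>I. s a * (M a c + M c a))"
  define e :: real where "e = (if t \<le> 0 then 1 else -1)"
  have e: "e * e = 1" "e * t \<le> 0" by (auto simp: e_def)
  define s' where "s' = s(c := e)"
  have s'I: "s' a = s a" if "a \<in> I" for a using insert that by (auto simp: s'_def)
  have s'c: "s' c = e" by (simp add: s'_def)
  have "(\<Sum>a\<in>insert c I. \<Sum>b\<in>insert c I. s' a * s' b * M a b)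
      = e * e * M c c + (\<Sum>b\<in>I. e * s b * M c b) + (\<Sum>a\<in>I. s a * e * M a c + (\<Sum>b\<in>I. s a * s b * M a b))"
    using insert by (simp add: s'I s'c cong: sum.cong)
  also have "\<dots> = M c c + e * t + (\<Sum>a\<in>I. \<Sum>b\<in>I. s a * s b * M a b)"
    by (simp add: e t_def sum.distrib sum_distrib_left algebra_simps)
  also have "\<dots> \<le> (\<Sum>a\<in>insert c I. M a a)"
    using e le insert by simp
  finally show ?case
    by (intro exI[of _ s']) (auto simp: s'_def s e)
qed

text \<open>Signs depend only on the label \<open>b i\<close>, so \<open>N\<close> can first be
  summed over pairs of blocks. The diagonal of the resulting \<open>M\<close> collects exactly the
  entries that a pinching keeps.\<close>

lemma exists_block_signs_le_pinched:
  fixes N :: "nat \<Rightarrow> nat \<Rightarrow> real" and b :: "nat \<Rightarrow> 'b"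
  obtains s :: "'b \<Rightarrow> real" where "\<forall>\<alpha>. s \<alpha> * s \<alpha> = 1"
    "(\<Sum>i<n. \<Sum>j<n. s (b i) * s (b j) * N i j) \<le> (\<Sum>i<n. \<Sum>j<n. if b i = b j then N i j else 0)"
proof -
  define I where "I = b ` {..<n}"
  define M where "M \<alpha> \<beta> = (\<Sum>i | i \<in> {..<n} \<and> b i = \<alpha>. \<Sum>j | j \<in> {..<n} \<and> b j = \<beta>. N i j)" for \<alpha> \<beta>
  have "finite I" by (simp add: I_def)
  then obtain s :: "'b \<Rightarrow> real" where s: "\<forall>\<alpha>. s \<alpha> * s \<alpha> = 1"
    and le: "(\<Sum>\<alpha>\<in>I. \<Sum>\<beta>\<in>I. s \<alpha> * s \<beta> * M \<alpha> \<beta>) \<le> (\<Sum>\<alpha>\<in>I. M \<alpha> \<alpha>)"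
    using exists_signs_le_diagonal[of I M] by blast
  have group: "(\<Sum>\<alpha>\<in>I. \<Sum>i | i \<in> {..<n} \<and> b i = \<alpha>. h i) = (\<Sum>i<n. h i)" for h :: "nat \<Rightarrow> real"
    by (rule sum.group) (auto simp: I_def)
  have "(\<Sum>\<alpha>\<in>I. \<Sum>\<beta>\<in>I. s \<alpha> * s \<beta> * M \<alpha> \<beta>)
    = (\<Sum>\<alpha>\<in>I. \<Sum>\<beta>\<in>I. \<Sum>i | i \<in> {..<n} \<and> b i = \<alpha>. \<Sum>j | j \<in> {..<n} \<and> b j = \<beta>. s (b i) * s (b j) * N i j)"
    unfolding M_def sum_distrib_left by (intro sum.cong refl) auto
  also have "\<dots> = (\<Sum>\<alpha>\<in>I. \<Sum>i | i \<in> {..<n} \<and> b i = \<alpha>. \<Sum>\<beta>\<in>I. \<Sum>j | j \<in> {..<n} \<and> b j = \<beta>. s (b i) * s (b j) * N i j)"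
    by (intro sum.cong refl sum.swap)
  also have "\<dots> = (\<Sum>i<n. \<Sum>j<n. s (b i) * s (b j) * N i j)"
    unfolding group ..
  finally have 1: "(\<Sum>\<alpha>\<in>I. \<Sum>\<beta>\<in>I. s \<alpha> * s \<beta> * M \<alpha> \<beta>) = (\<Sum>i<n. \<Sum>j<n. s (b i) * s (b j) * N i j)" .
  have "(\<Sum>\<alpha>\<in>I. M \<alpha> \<alpha>) = (\<Sum>\<alpha>\<in>I. \<Sum>i | i \<in> {..<n} \<and> b i = \<alpha>. \<Sum>j<n. if b i = b j then N i j else 0)"
    unfolding M_def
    by (rule sum.cong[OF refl], rule sum.cong[OF refl], subst sum.inter_filter[OF finite_lessThan])
      (auto intro!: sum.cong)
  also have "\<dots> = (\<Sum>i<n. \<Sum>j<n. if b i = b j then N i j else 0)"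
    by (rule group)
  finally show ?thesis using that[OF s] le 1 by simp
qed

text \<open>For a given \<open>v\<close>, flip signs blockwise to a vector \<open>w\<close> whose
  form under \<open>E\<close> is at most the form of \<open>v\<close> under \<open>C\<close>. As
  \<open>w\<close> is nonzero too, the smaller value is already positive.\<close>

lemma positive_definite_pinched:
  assumes E: "positive_definite E" "E \<in> carrier_mat n n" and C: "C \<in> carrier_mat n n"
    and C_eq: "\<And>i j. i < n \<Longrightarrow> j < n \<Longrightarrow> C $$ (i,j) = (if b i = b j then E $$ (i,j) else 0)"
  shows "positive_definite C"
proof -
  have "E $$ (i,j) = E $$ (j,i)" if "i < n" "j < n" for i j
    using that E(2) positive_definiteD(1)[OF E] by (metis carrier_matD index_transpose_mat(1))
  then have T: "transpose_mat C = C"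
    using C by (intro eq_matI) (auto simp: C_eq)
  have "0 < v \<bullet> (C *\<^sub>v v)" if v: "v \<in> carrier_vec n" "v \<noteq> 0\<^sub>v n" for v
  proof -
    obtain s where s: "\<forall>\<alpha>. s \<alpha> * s \<alpha> = (1::real)"
      and le: "(\<Sum>i<n. \<Sum>j<n. s (b i) * s (b j) * (v $ i * E $$ (i,j) * v $ j))
        \<le> (\<Sum>i<n. \<Sum>j<n. if b i = b j then v $ i * E $$ (i,j) * v $ j else 0)"
      by (rule exists_block_signs_le_pinched)
    define w where "w = vec n (\<lambda>i. s (b i) * v $ i)"
    have w: "w \<in> carrier_vec n" by (simp add: w_def)
    have "w \<noteq> 0\<^sub>v n"
    proof
      assume w0: "w = 0\<^sub>v n"
      have "v $ i = 0" if "i < n" for i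
      proof -
        have "s (b i) * w $ i = 0" using w0 that by simp
        then show ?thesis using that s[rule_format, of "b i"] by (simp add: w_def mult.assoc[symmetric])
      qed
      then show False using v by (metis carrier_vecD eq_vecI index_zero_vec)
    qed
    then have "0 < w \<bullet> (E *\<^sub>v w)" using positive_definiteD(2)[OF E] w by blast
    also have "\<dots> = (\<Sum>i<n. \<Sum>j<n. s (b i) * s (b j) * (v $ i * E $$ (i,j) * v $ j))"
      unfolding scalar_prod_mult_mat_vec_eq_sum[OF w E(2)]
      by (intro sum.cong refl) (auto simp: w_def)
    also note le
    also have "(\<Sum>i<n. \<Sum>j<n. if b i = b j then v $ i * E $$ (i,j) * v $ j else 0) = v \<bullet> (C *\<^sub>v v)"
      unfolding scalar_prod_mult_mat_vec_eq_sum[OF v(1) C]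
      by (intro sum.cong refl) (auto simp: C_eq)
    finally show ?thesis .
  qed
  then show ?thesis using C T unfolding positive_definite_def by auto
qed

lemma weakly_supermajorized_vecI:
  assumes "mono_on {..<n} c" "mono_on {..<n} d"
    and "\<And>l. l \<le> n \<Longrightarrow> (\<Sum>j<l. d j) \<le> (\<Sum>j<l. c j)"
  shows "vec n c \<prec>\<^sup>w vec n d"
proof -
  have srt: "vec_sort (vec n f) $ j = f j" if "mono_on {..<n} f" "j < n" for f :: "nat \<Rightarrow> real" and j
  proof -
    have eq: "list_of_vec (vec n f) = map f [0..<n]"
      by (intro nth_equalityI) (auto simp: list_of_vec_index)
    have "sorted (map f [0..<n])"
      using that(1) by (auto simp: sorted_iff_nth_mono monotone_on_def)
    then show ?thesis
      using that(2) by (simp add: vec_sort_def eq sorted_sort_id vec_of_list_index del: vec_of_list_map)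
  qed
  show ?thesis
    unfolding weakly_supermajorized_def
  proof (intro conjI ballI)
    fix l assume "l \<in> {1..dim_vec (vec n c)}"
    then have "l \<le> n" by simp
    then show "(\<Sum>j<l. vec_sort (vec n d) $ j) \<le> (\<Sum>j<l. vec_sort (vec n c) $ j)"
      using assms by (simp add: srt)
  qed simp
qed

text \<open>The first \<open>l\<close> columns of \<open>X\<close> and \<open>Y\<close> attain the
  minimum for the pinched pair; with signs flipped blockwise they are admissible for
  \<open>E\<close> and \<open>G\<close>. The pinching enters only through a labelling
  \<open>b\<close> of the indices, so the list of block sizes stays out of the argument.\<close>

lemma pinched_weakly_supermajorized:
  assumes E: "positive_definite E" "E \<in> carrier_mat n n"
    and G: "positive_definite G" "G \<in> carrier_mat n n"
    and CE: "CE \<in> carrier_mat n n" and CG: "CG \<in> carrier_mat n n"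
    and CE_eq: "\<And>i j. i < n \<Longrightarrow> j < n \<Longrightarrow> CE $$ (i,j) = (if b i = b j then E $$ (i,j) else 0)"
    and CG_eq: "\<And>i j. i < n \<Longrightarrow> j < n \<Longrightarrow> CG $$ (i,j) = (if b i = b j then G $$ (i,j) else 0)"
  shows "eigenvalue_vec (mat_sqrt (mat_sqrt CG * CE * mat_sqrt CG))
    \<prec>\<^sup>w eigenvalue_vec (mat_sqrt (mat_sqrt G * E * mat_sqrt G))"
proof -
  obtain T S d where T: "T \<in> carrier_mat n n" "S \<in> carrier_mat n n" "transpose_mat T * S = 1\<^sub>m n"
    and TE: "transpose_mat T * E * T = mat_diag n d" and SG: "transpose_mat S * G * S = mat_diag n d"
    and d: "mono_on {..<n} d" "\<forall>i<n. 0 < d i"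
    and ev: "eigenvalue_vec (mat_sqrt (mat_sqrt G * E * mat_sqrt G)) = vec n d"
    by (rule simultaneous_diagonalization[OF E G])
  obtain X Y c where X: "X \<in> carrier_mat n n" "Y \<in> carrier_mat n n" "transpose_mat X * Y = 1\<^sub>m n"
    and XE: "transpose_mat X * CE * X = mat_diag n c" and YG: "transpose_mat Y * CG * Y = mat_diag n c"
    and c: "mono_on {..<n} c" "\<forall>i<n. 0 < c i"
    and evC: "eigenvalue_vec (mat_sqrt (mat_sqrt CG * CE * mat_sqrt CG)) = vec n c"
    by (rule simultaneous_diagonalization[OF positive_definite_pinched[OF E CE CE_eq] CE
          positive_definite_pinched[OF G CG CG_eq] CG])
  have "(\<Sum>j<l. d j) \<le> (\<Sum>j<l. c j)" if l: "l \<le> n" for l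
  proof -
    \<comment> \<open>One choice of signs has to serve both matrices and all \<open>l\<close>
      columns, so it is made for the total of all these terms.\<close>
    define N where "N i j = (\<Sum>a<l. X $$ (i,a) * E $$ (i,j) * X $$ (j,a) + Y $$ (i,a) * G $$ (i,j) * Y $$ (j,a))"
      for i j
    obtain s where s: "\<forall>\<alpha>. s \<alpha> * s \<alpha> = (1::real)"
      and le: "(\<Sum>i<n. \<Sum>j<n. s (b i) * s (b j) * N i j) \<le> (\<Sum>i<n. \<Sum>j<n. if b i = b j then N i j else 0)"
      by (rule exists_block_signs_le_pinched)
    define x where "x i a = s (b i) * X $$ (i,a)" for i a
    define y where "y i a = s (b i) * Y $$ (i,a)" for i a
    have "(\<Sum>i<n. x i a * y i a') = of_bool (a = a')" if "a < l" "a' < l" for a a'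
    proof -
      \<comment> \<open>The two equal signs in each row cancel, so the flipped columns are still
        biorthogonal.\<close>
      have "x i a * y i a' = X $$ (i,a) * Y $$ (i,a')" for i
        using s[rule_format, of "b i"] by (simp add: x_def y_def algebra_simps)
      then have "(\<Sum>i<n. x i a * y i a') = (transpose_mat X * Y) $$ (a,a')"
        using that l X(1,2) by (simp add: scalar_prod_def lessThan_atLeast0)
      then show ?thesis using that l by (simp add: X(3))
    qed
    then have "2 * (\<Sum>j<l. d j) \<le>
        (\<Sum>a<l. \<Sum>i<n. \<Sum>j<n. x i a * E $$ (i,j) * x j a + y i a * G $$ (i,j) * y j a)"
      by (intro biorthogonal_trace_ge[OF T E(2) TE G(2) SG d])
    also have "\<dots> = (\<Sum>i<n. \<Sum>j<n. \<Sum>a<l. x i a * E $$ (i,j) * x j a + y i a * G $$ (i,j) * y j a)"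
      by (subst sum.swap, rule sum.cong[OF refl], rule sum.swap)
    also have "\<dots> = (\<Sum>i<n. \<Sum>j<n. s (b i) * s (b j) * N i j)"
      unfolding N_def sum_distrib_left by (intro sum.cong refl) (simp add: x_def y_def algebra_simps)
    also note le
    also have "(\<Sum>i<n. \<Sum>j<n. if b i = b j then N i j else 0)
      = (\<Sum>i<n. \<Sum>j<n. \<Sum>a<l. X $$ (i,a) * CE $$ (i,j) * X $$ (j,a) + Y $$ (i,a) * CG $$ (i,j) * Y $$ (j,a))"
      unfolding N_def by (intro sum.cong refl) (auto simp: CE_eq CG_eq)
    also have "\<dots> = (\<Sum>a<l. \<Sum>i<n. \<Sum>j<n. X $$ (i,a) * CE $$ (i,j) * X $$ (j,a) + Y $$ (i,a) * CG $$ (i,j) * Y $$ (j,a))"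
      by (subst (2) sum.swap, subst sum.swap) simp
    also have "\<dots> = (\<Sum>a<l. (transpose_mat X * CE * X) $$ (a,a) + (transpose_mat Y * CG * Y) $$ (a,a))"
    proof (intro sum.cong refl)
      fix a assume "a \<in> {..<l}"
      with l have a: "a < n" by simp
      show "(\<Sum>i<n. \<Sum>j<n. X $$ (i,a) * CE $$ (i,j) * X $$ (j,a) + Y $$ (i,a) * CG $$ (i,j) * Y $$ (j,a))
        = (transpose_mat X * CE * X) $$ (a,a) + (transpose_mat Y * CG * Y) $$ (a,a)"
        unfolding index_congruence[OF X(1) CE X(1) a a] index_congruence[OF X(2) CG X(2) a a] sum.distrib ..
    qed
    \<comment> \<open>Each column contributes \<open>c a\<close> once through \<open>CE\<close> and
      once through \<open>CG\<close>.\<close>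
    also have "\<dots> = 2 * (\<Sum>a<l. c a)"
      unfolding XE YG sum_distrib_left using l by (intro sum.cong refl) (auto simp: mat_diag_def)
    finally show ?thesis by simp
  qed
  then show ?thesis unfolding ev evC by (intro weakly_supermajorized_vecI c d)
qed

section \<open>Entries of a pinching\<close>

text \<open>Labels for the sign argument: two indices in range lie in the same diagonal block
  exactly when their labels agree. An index beyond \<open>sum_list ms\<close> gets the label
  \<open>length ms\<close>, which no index in range has.\<close>

fun block_index :: "nat list \<Rightarrow> nat \<Rightarrow> nat" where
  "block_index [] i = 0"
| "block_index (m # ms) i = (if i < m then 0 else Suc (block_index ms (i - m)))"

text \<open>Stated for an entry function \<open>h\<close> instead of a matrix, so that after
  removing the first block the induction can continue with \<open>h\<close> shifted by
  \<open>m\<close> in both arguments.\<close>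

lemma diag_block_mat_diagonal_blocks:
  fixes h :: "nat \<Rightarrow> nat \<Rightarrow> 'a :: zero"
  defines "D \<equiv> (\<lambda>ms h. diag_block_mat (map (\<lambda>k. mat (ms ! k) (ms ! k)
      (\<lambda>(a, b). h (sum_list (take k ms) + a) (sum_list (take k ms) + b))) [0..<length ms]))"
  shows "D ms h \<in> carrier_mat (sum_list ms) (sum_list ms)" (is ?carrier)
    and "i < sum_list ms \<Longrightarrow> j < sum_list ms \<Longrightarrow>
      D ms h $$ (i,j) = (if block_index ms i = block_index ms j then h i j else 0)" (is "_ \<Longrightarrow> _ \<Longrightarrow> ?entry i j")
proof -
  have "D ms h \<in> carrier_mat (sum_list ms) (sum_list ms) \<and> (\<forall>i < sum_list ms. \<forall>j < sum_list ms.
      D ms h $$ (i,j) = (if block_index ms i = block_index ms j then h i j else 0))"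
  proof (induction ms arbitrary: h)
    case Nil
    then show ?case by (simp add: D_def)
  next
    case (Cons m ms)
    define h' where "h' i j = h (m + i) (m + j)" for i j
    have h'_app: "h' i j = h (m + i) (m + j)" for i j by (simp add: h'_def)
    have dim: "dim_row (D ms h') = sum_list ms" "dim_col (D ms h') = sum_list ms"
      using Cons.IH[of h'] by auto
    have entry: "D ms h' $$ (i,j) = (if block_index ms i = block_index ms j then h (m + i) (m + j) else 0)"
      if "i < sum_list ms" "j < sum_list ms" for i j
      using Cons.IH[of h', THEN conjunct2, rule_format, OF that] by (simp only: h'_app)
    have step: "D (m # ms) h = four_block_mat (mat m m (\<lambda>(a,b). h a b)) (0\<^sub>m m (sum_list ms))
        (0\<^sub>m (sum_list ms) m) (D ms h')"
      using dim unfolding D_def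
      by (simp add: map_upt_Suc Let_def h'_def add.assoc del: upt_Suc)
    show ?case
    proof (intro conjI allI impI)
      show "D (m # ms) h \<in> carrier_mat (sum_list (m # ms)) (sum_list (m # ms))"
        unfolding step using dim by (auto intro!: carrier_matI)
      fix i j assume ij: "i < sum_list (m # ms)" "j < sum_list (m # ms)"
      have "h (m + (i - m)) (m + (j - m)) = h i j" if "\<not> i < m" "\<not> j < m"
        using that by simp
      then show "D (m # ms) h $$ (i,j) = (if block_index (m # ms) i = block_index (m # ms) j then h i j else 0)"
        unfolding step using dim ij by (simp add: entry)
    qed
  qed
  then show ?carrier and "i < sum_list ms \<Longrightarrow> j < sum_list ms \<Longrightarrow> ?entry i j" by auto
qed

lemma pinching_carrier: "pinching ms H \<in> carrier_mat (sum_list ms) (sum_list ms)"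
  unfolding pinching_def mat_block_def
  by (rule diag_block_mat_diagonal_blocks(1)[of ms "\<lambda>i j. H $$ (i,j)"])

lemma index_pinching:
  assumes "i < sum_list ms" "j < sum_list ms"
  shows "pinching ms H $$ (i,j) = (if block_index ms i = block_index ms j then H $$ (i,j) else 0)"
  unfolding pinching_def mat_block_def
  by (rule diag_block_mat_diagonal_blocks(2)[of i ms j "\<lambda>i j. H $$ (i,j)", OF assms])

section \<open>From the block matrix to the pair of its diagonal blocks\<close>

text \<open>Testing the big form on vectors with one half equal to zero leaves the form of
  \<open>E\<close> or of \<open>G\<close>; symmetry is read off the corresponding blocks.\<close>

lemma positive_definite_diagonal_blocks:
  assumes E: "E \<in> carrier_mat n n" and F: "F \<in> carrier_mat n n" and G: "G \<in> carrier_mat n n"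
    and A: "positive_definite (four_block_mat E F (transpose_mat F) G)" (is "positive_definite ?A")
  shows "positive_definite E" "positive_definite G"
proof -
  have FT: "transpose_mat F \<in> carrier_mat n n" using F by simp
  have AC: "?A \<in> carrier_mat (n + n) (n + n)" using E G by simp
  have "transpose_mat ?A = four_block_mat (transpose_mat E) F (transpose_mat F) (transpose_mat G)"
    using transpose_four_block_mat[OF E F FT G] by simp
  then have sym: "four_block_mat (transpose_mat E) F (transpose_mat F) (transpose_mat G) = ?A"
    using positive_definiteD(1)[OF A AC] by simp
  have ET: "transpose_mat E = E"
  proof (intro eq_matI)
    fix i j assume "i < dim_row E" "j < dim_col E"
    then show "transpose_mat E $$ (i,j) = E $$ (i,j)"
      using arg_cong[OF sym, of "\<lambda>B. B $$ (i,j)"] E G by simp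
  qed (use E in auto)
  have GT: "transpose_mat G = G"
  proof (intro eq_matI)
    fix i j assume "i < dim_row G" "j < dim_col G"
    then show "transpose_mat G $$ (i,j) = G $$ (i,j)"
      using arg_cong[OF sym, of "\<lambda>B. B $$ (n + i,n + j)"] E G by simp
  qed (use G in auto)
  have pos: "0 < v \<bullet> (E *\<^sub>v v + F *\<^sub>v w) + w \<bullet> (transpose_mat F *\<^sub>v v + G *\<^sub>v w)"
    if "v \<in> carrier_vec n" "w \<in> carrier_vec n" "v \<noteq> 0\<^sub>v n \<or> w \<noteq> 0\<^sub>v n" for v w
  proof -
    have "v @\<^sub>v w \<noteq> 0\<^sub>v (n + n)"
    proof
      assume 0: "v @\<^sub>v w = 0\<^sub>v (n + n)"
      have "v $ i = 0" "w $ i = 0" if "i < n" for i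
        using arg_cong[OF 0, of "\<lambda>u. u $ i"] arg_cong[OF 0, of "\<lambda>u. u $ (n + i)"] that
          \<open>v \<in> carrier_vec n\<close> \<open>w \<in> carrier_vec n\<close> by simp_all
      then show False using that by (metis carrier_vecD eq_vecI index_zero_vec)
    qed
    then have "0 < (v @\<^sub>v w) \<bullet> (?A *\<^sub>v (v @\<^sub>v w))"
      using that by (intro positive_definiteD(2)[OF A AC]) auto
    then show ?thesis
      using that E F FT G
      by (simp add: four_block_mat_mult_vec[OF E F FT G] scalar_prod_append[of _ n _ n])
  qed
  have "0 < v \<bullet> (E *\<^sub>v v)" if "v \<in> carrier_vec n" "v \<noteq> 0\<^sub>v n" for v
  proof -
    have "F *\<^sub>v 0\<^sub>v n = 0\<^sub>v n" "G *\<^sub>v 0\<^sub>v n = 0\<^sub>v n" using F G by auto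
    then show ?thesis using pos[of v "0\<^sub>v n"] that E F FT by simp
  qed
  then show "positive_definite E" unfolding positive_definite_def using ET E by auto
  have "0 < v \<bullet> (G *\<^sub>v v)" if "v \<in> carrier_vec n" "v \<noteq> 0\<^sub>v n" for v
  proof -
    have "E *\<^sub>v 0\<^sub>v n = 0\<^sub>v n" "transpose_mat F *\<^sub>v 0\<^sub>v n = 0\<^sub>v n" using E FT by auto
    then show ?thesis using pos[of "0\<^sub>v n" v] that G F FT by simp
  qed
  then show "positive_definite G" unfolding positive_definite_def using GT G by auto
qed

theorem corollary3p5:
  fixes n :: nat and ms :: "nat list" and A E F G :: "real mat"
  assumes "n \<ge> 1"
    and "E \<in> carrier_mat n n" and "F \<in> carrier_mat n n" and "G \<in> carrier_mat n n"
    and "A = four_block_mat E F (transpose_mat F) G"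
    and "positive_definite A"
    and "\<forall>m \<in> set ms. m > 0" and "sum_list ms = n"
  shows "eigenvalue_vec (mat_sqrt (mat_sqrt (pinching ms G) * pinching ms E * mat_sqrt (pinching ms G)))
           \<prec>\<^sup>w eigenvalue_vec (mat_sqrt (mat_sqrt G * E * mat_sqrt G))
       \<and> eigenvalue_vec (mat_sqrt (pinching ms E)) \<prec>\<^sup>w eigenvalue_vec (mat_sqrt E)"
proof
  have E: "positive_definite E" and G: "positive_definite G"
    using positive_definite_diagonal_blocks[OF assms(2-4)] assms(5,6) by auto
  have carrier: "pinching ms H \<in> carrier_mat n n" for H :: "real mat"
    using pinching_carrier[of ms H] assms(8) by simp
  have entry: "pinching ms H $$ (i,j) = (if block_index ms i = block_index ms j then H $$ (i,j) else 0)"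
    if "i < n" "j < n" for H :: "real mat" and i j
    using index_pinching[of i ms j H] that assms(8) by simp
  show "eigenvalue_vec (mat_sqrt (mat_sqrt (pinching ms G) * pinching ms E * mat_sqrt (pinching ms G)))
           \<prec>\<^sup>w eigenvalue_vec (mat_sqrt (mat_sqrt G * E * mat_sqrt G))"
    by (rule pinched_weakly_supermajorized[OF E assms(2) G assms(4) carrier carrier entry entry])
  \<comment> \<open>The identity is positive definite, equals its own root and is fixed by the
    pinching, so taking it in place of \<open>G\<close> collapses the products to \<open>E\<close>
    and its pinching.\<close>
  have one: "positive_definite (1\<^sub>m n)"
    using positive_definite_mat_diag[of n "\<lambda>_. 1"] by simp
  have root: "mat_sqrt (1\<^sub>m n) = 1\<^sub>m n" by (rule mat_sqrt_eqI[OF one]) simp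
  have pinch_one: "pinching ms (1\<^sub>m n :: real mat) = 1\<^sub>m n"
    using carrier[of "1\<^sub>m n"] by (intro eq_matI) (auto simp: entry)
  have "eigenvalue_vec (mat_sqrt (mat_sqrt (pinching ms (1\<^sub>m n)) * pinching ms E * mat_sqrt (pinching ms (1\<^sub>m n))))
           \<prec>\<^sup>w eigenvalue_vec (mat_sqrt (mat_sqrt (1\<^sub>m n) * E * mat_sqrt (1\<^sub>m n)))"
    by (rule pinched_weakly_supermajorized[OF E assms(2) one one_carrier_mat carrier carrier entry entry])
  then show "eigenvalue_vec (mat_sqrt (pinching ms E)) \<prec>\<^sup>w eigenvalue_vec (mat_sqrt E)"
    using assms(2) carrier[of E]
    by (simp add: pinch_one root left_mult_one_mat[of _ n n] right_mult_one_mat[of _ n n])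
qed

end
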